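(* Let $d,m\ge 1$ be integers, $n=d+m$, let $A\in\mathbb{R}^{(d+1)\times m}$ and let $\mathcal{L}=\mathcal{L}_A=\{(\bm{x},\widetilde{\bm{x}}A)\mid \bm{x}\in\mathbb{R}^d\}\subset\mathbb{R}^n$, where $\widetilde{\bm{x}}=(1,\bm{x})$. Then $$\mathcal{L}\text{ is extremal}\iff \omega(A)\le n.$$
   Context: Vectors are row vectors; $|\cdot|$ is the supremum norm; $\|\bm{y}\|=\min_{\bm{k}}|\bm{y}-\bm{k}|$ (over integer vectors $\bm{k}$) is the sup-norm distance to the nearest integer vector; the same notation is used for column vectors. The diophantine exponent $\omega(A)\in[0,\infty]$ of a real matrix $A$ with $m$ columns is the supremum of all $\omega\in\mathbb{R}$ such that $\|A\bm{q}^{\mathrm T}\|<|\bm{q}|^{-\omega}$ holds for infinitely many $\bm{q}\in\mathbb{Z}^m$. For $\tau\in\mathbb{R}$ let $\mathcal{S}_n(\tau)=\{\bm{y}\in\mathbb{R}^n: \|q\bm{y}\|<q^{-\tau}\text{ for infinitely many }q\in\mathbb{N}\}$. A submanifold $\mathcal{M}\subseteq\mathbb{R}^n$ is extremal if $|\mathcal{S}_n(\tau)\cap\mathcal{M}|_{\mathcal{M}}=0$ for every $\tau>1/n$, where $|\cdot|_{\mathcal{M}}$ is the induced Lebesgue measure on $\mathcal{M}$. *)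

theory Defs
  imports "HOL-Analysis.Analysis"
begin

definition integer_vectors :: "(real ^ 'n) set" where
  "integer_vectors = {k. \<forall>i. k $ i \<in> \<int>}"

text \<open>The minimum over integer vectors is attained, so the infimum below is the minimum.\<close>

definition dist_int :: "real ^ 'n \<Rightarrow> real" where
  "dist_int y = (INF k\<in>integer_vectors. infnorm (y - k))"

text \<open>The vector \<open>q = 0\<close> never satisfies the inequality, since \<open>0 powr x = 0\<close>.\<close>

definition dioph_exponent :: "real ^ 'm ^ 'k \<Rightarrow> ereal" where
  "dioph_exponent A =
     (SUP w \<in> {w :: real. infinite {q \<in> integer_vectors.
                  dist_int (A *v q) < infnorm q powr (- w)}}. ereal w)"

definition approximable :: "real \<Rightarrow> (real ^ 'n) set" where
  "approximable \<tau> =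
     {y. infinite {q :: nat. q > 0 \<and> dist_int (real q *\<^sub>R y) < real q powr (- \<tau>)}}"

text \<open>
  Embedded \<open>C\<^sup>1\<close> submanifolds of dimension \<open>CARD('d)\<close> are described by local
  parametrizations: \<open>C\<^sup>1\<close> immersions of an open set \<open>U\<close> that are homeomorphisms
  onto a relatively open subset of \<open>M\<close>.
\<close>

definition local_parametrization ::
    "(real ^ 'n) set \<Rightarrow> (real ^ 'd) set \<Rightarrow> (real ^ 'd \<Rightarrow> real ^ 'n) \<Rightarrow> bool" where
  "local_parametrization M U \<phi> \<longleftrightarrow>
     open U \<and>
     (\<forall>x\<in>U. \<phi> differentiable (at x)) \<and>
     continuous_on U (\<lambda>x. jacobian \<phi> (at x)) \<and>
     (\<forall>x\<in>U. inj ((*v) (jacobian \<phi> (at x)))) \<and>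
     (\<exists>\<psi>. homeomorphism U (\<phi> ` U) \<phi> \<psi>) \<and>
     openin (top_of_set M) (\<phi> ` U)"

definition submanifold :: "'d::finite itself \<Rightarrow> (real ^ 'n) set \<Rightarrow> bool" where
  "submanifold TYPE('d) M \<longleftrightarrow>
     (\<forall>p\<in>M. \<exists>(U :: (real ^ 'd) set) \<phi>. local_parametrization M U \<phi> \<and> p \<in> \<phi> ` U)"

definition volume_density :: "(real ^ 'd \<Rightarrow> real ^ 'n) \<Rightarrow> real ^ 'd \<Rightarrow> real" where
  "volume_density \<phi> x =
     sqrt (det (transpose (jacobian \<phi> (at x)) ** jacobian \<phi> (at x)))"

text \<open>
  The induced Lebesgue (Riemannian volume) measure, as an outer measure on all subsets of
  \<open>M\<close>: a piece \<open>\<phi> ` B\<close>, with \<open>B\<close> a Borel subset of the domain of a local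
  parametrization \<open>\<phi>\<close>, has volume \<open>\<integral>\<^sub>B sqrt (det (D\<phi>\<^sup>T D\<phi>))\<close>; an
  arbitrary set gets the least total volume of a countable cover by such pieces.
\<close>

definition induced_measure ::
    "'d::finite itself \<Rightarrow> (real ^ 'n) set \<Rightarrow> (real ^ 'n) set \<Rightarrow> ennreal" where
  "induced_measure TYPE('d) M E =
     Inf {\<Sum>k. \<integral>\<^sup>+ x\<in>B k. ennreal (volume_density (\<phi> k) x) \<partial>lborel
          | (U :: nat \<Rightarrow> (real ^ 'd) set) \<phi> B.
            (\<forall>k. local_parametrization M (U k) (\<phi> k) \<and> B k \<in> sets borel \<and> B k \<subseteq> U k) \<and>
            E \<subseteq> (\<Union>k. \<phi> k ` B k)}"

definition extremal :: "'d::finite itself \<Rightarrow> (real ^ 'n) set \<Rightarrow> bool" where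
  "extremal TYPE('d) M \<longleftrightarrow>
     submanifold TYPE('d) M \<and>
     (\<forall>\<tau>. \<tau> > 1 / real CARD('n) \<longrightarrow> induced_measure TYPE('d) M (approximable \<tau> \<inter> M) = 0)"

text \<open>
  The coordinates of \<open>(1, x)\<close> are indexed by \<open>'d option\<close>, with \<open>None\<close> the index of the
  leading \<open>1\<close>, and those of a concatenation \<open>(x, y)\<close> by \<open>'d + 'm\<close>.
\<close>

definition prepend_one :: "real ^ 'd \<Rightarrow> real ^ ('d::finite option)" where
  "prepend_one x = (\<chi> i. case i of None \<Rightarrow> 1 | Some j \<Rightarrow> x $ j)"

definition concat_vec :: "real ^ 'd \<Rightarrow> real ^ 'm \<Rightarrow> real ^ ('d::finite + 'm::finite)" where
  "concat_vec x y = (\<chi> i. case i of Inl j \<Rightarrow> x $ j | Inr k \<Rightarrow> y $ k)"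

definition affine_graph :: "real ^ 'm ^ ('d option) \<Rightarrow> (real ^ ('d::finite + 'm::finite)) set" where
  "affine_graph A = {concat_vec x (prepend_one x v* A) | x. True}"

end

theory Submission
  imports Defs
begin

text \<open>
  Put \<open>n = d + m\<close> and parametrize the affine graph by the affine map
  \<open>\<phi>(x) = (x, (1, x) A)\<close> on the whole of \<open>\<real>\<^sup>d\<close>.  Both implications compare rational points near
  the graph with integer vectors \<open>s\<close> for which \<open>A s\<close> is nearly integral.

  \<^emph>\<open>A small exponent gives extremality.\<close>  If \<open>\<parallel>q \<phi>(x)\<parallel> < q\<^bsup>-\<tau>\<^esup>\<close>, then the nearest integer vector to
  \<open>q (1, x)\<close> is some \<open>u = (q, p)\<close> with \<open>u A\<close> within \<open>O(q\<^bsup>-\<tau>\<^esup>)\<close> of an integer vector, and \<open>x\<close> lies in a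
  cube of side \<open>2 q\<^bsup>-\<tau>-1\<^esup>\<close> round \<open>p / q\<close>.  So it suffices to count such \<open>u\<close>.  If \<open>\<omega>(A) \<le> n\<close> and \<open>w > n\<close>,
  then the \<open>K\<^sup>m\<close> points \<open>A s\<close> with \<open>0 \<le> s\<^sub>j < K\<close> are separated modulo 1 by a constant times
  \<open>K\<^bsup>-w\<^esup>\<close>.  When \<open>u A\<close> is within \<open>1 / (16 m K)\<close> of the integers, each number \<open>u \<cdot> A s\<close> is nearly an
  integer, so the trigonometric polynomial \<open>\<Sum>\<^sub>u e(u \<cdot> y)\<close> is as large as possible, up to a factor 2,
  near every point \<open>A s\<close>.  By Parseval its mean square is only the number of \<open>u\<close>; hence there are
  few \<open>u\<close> (lemma \<open>card_integer_vectors_near_kernel_le\<close>).  With \<open>K = 2\<^sup>t\<close> and \<open>q\<close> in the range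
  \<open>2\<^bsup>nt\<^esup> \<le> q < 2\<^bsup>n(t+1)\<^esup>\<close> the cubes have total volume \<open>O(2\<^bsup>-\<sigma>t\<^esup>)\<close> for some \<open>\<sigma> > 0\<close>, and the
  Borel--Cantelli lemma shows that the approximable parameters \<open>x\<close> form a null set
  (\<open>chart_approximable_null\<close>).

  \<^emph>\<open>A large exponent destroys extremality.\<close>  If \<open>\<omega>(A) > w > n\<close>, then infinitely many \<open>s\<close> satisfy
  \<open>\<parallel>A s\<parallel> < |s|\<^bsup>-w\<^esup>\<close>.  Pairing \<open>(1, x)\<close> with \<open>A s\<close> minus its nearest integer vector shows that each point
  \<open>\<phi>(x)\<close> lies within \<open>O(|s|\<^bsup>-w\<^esup>)\<close> of a rational hyperplane of height \<open>O(|s|)\<close>.  A pigeonhole form of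
  Khintchine's transference principle (\<open>simultaneous_approximation_of_linear_form\<close>) turns this into
  simultaneous approximation with an exponent \<open>\<tau> > 1/n\<close> independent of \<open>x\<close>, so the whole graph is
  approximable.  Its volume is infinite: on an affine graph the density of any parametrization is a
  constant times the Jacobian of its projection to \<open>\<real>\<^sup>d\<close>, so a cover of the graph by pieces of finite
  total volume would cover \<open>\<real>\<^sup>d\<close> by sets of finite total measure.
\<close>

section \<open>Counting integer vectors by Parseval\<close>

text \<open>
  Dividing by \<open>M\<close> gives a grid of mesh \<open>1 / M\<close> on the cube \<open>[0, 3)\<^sup>k\<close>, which is three periods long in each
  direction.  A ball of radius at most 1 round a representative in \<open>[1, 2)\<^sup>k\<close> of a point of the torus
  stays inside it, so no ball has to be wrapped round.
\<close>

definition torus_grid :: "nat \<Rightarrow> ('k::finite \<Rightarrow> nat) set" where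
  "torus_grid M = (\<Pi>\<^sub>E i\<in>UNIV. {..<3 * M})"

definition character :: "nat \<Rightarrow> ('k::finite \<Rightarrow> int) \<Rightarrow> ('k \<Rightarrow> nat) \<Rightarrow> complex" where
  "character M u a = cis (2 * pi * (\<Sum>i\<in>UNIV. of_int (u i) * (real (a i) / real M)))"

lemma finite_torus_grid: "finite (torus_grid M :: ('k::finite \<Rightarrow> nat) set)"
  unfolding torus_grid_def by (intro finite_PiE) auto

lemma sum_roots_of_unity_eq_0:
  fixes j :: int
  assumes "M > 0" "\<not> int M dvd j"
  shows "(\<Sum>a<3 * M. cis (2 * pi * (of_int j * (real a / real M)))) = 0"
proof -
  define z where "z = cis (2 * pi * of_int j / real M)"
  have pw: "cis (2 * pi * (of_int j * (real a / real M))) = z ^ a" for a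
    unfolding z_def Complex.DeMoivre by (simp add: field_simps)
  have "z \<noteq> 1"
  proof
    assume "z = 1"
    then have "cos (2 * pi * of_int j / real M) = 1"
      unfolding z_def by (metis cis.simps(1) one_complex.simps(1))
    then obtain n :: int where "2 * pi * of_int j / real M = of_int n * 2 * pi"
      using cos_one_2pi_int by blast
    then have "real_of_int j = of_int n * real M"
      using assms(1) by (simp add: field_simps)
    then have "j = n * int M"
      by (metis of_int_eq_iff of_int_mult of_int_of_nat_eq)
    then show False using assms(2) by simp
  qed
  moreover have "z ^ (3 * M) = 1"
  proof -
    have "z ^ (3 * M) = cis (2 * pi * of_int (3 * j))"
      unfolding z_def Complex.DeMoivre using assms(1) by (simp add: field_simps)
    also have "\<dots> = 1" by (rule cis_multiple_2pi) (rule Ints_of_int)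
    finally show ?thesis .
  qed
  ultimately have "(\<Sum>a<3 * M. z ^ a) = 0"
    using geometric_sum[of z "3 * M"] by (metis diff_self div_0)
  then show ?thesis
    by (simp only: pw)
qed

lemma character_orthogonality:
  fixes u v :: "'k::finite \<Rightarrow> int"
  assumes "M > 0" and bd: "\<And>i. \<bar>u i\<bar> \<le> Q" "\<And>i. \<bar>v i\<bar> \<le> Q" and M: "int M > 2 * Q"
  shows "(\<Sum>a\<in>torus_grid M. character M u a * cnj (character M v a)) =
    (if u = v then of_nat ((3 * M) ^ CARD('k)) else 0)"
proof -
  have "character M u a * cnj (character M v a) =
      (\<Prod>i\<in>UNIV. cis (2 * pi * (of_int (u i - v i) * (real (a i) / real M))))" for a
  proof -
    have "character M u a * cnj (character M v a) =
        cis (\<Sum>i\<in>UNIV. 2 * pi * (of_int (u i - v i) * (real (a i) / real M)))"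
      unfolding character_def cis_cnj cis_mult
      by (simp add: sum_subtractf sum_distrib_left algebra_simps)
    also have "\<dots> = (\<Prod>i\<in>UNIV. cis (2 * pi * (of_int (u i - v i) * (real (a i) / real M))))"
      by (simp add: cis_conv_exp exp_sum sum_distrib_left)
    finally show ?thesis .
  qed
  then have eq: "(\<Sum>a\<in>torus_grid M. character M u a * cnj (character M v a)) =
     (\<Prod>i\<in>UNIV. \<Sum>x<3 * M. cis (2 * pi * (of_int (u i - v i) * (real x / real M))))"
    unfolding torus_grid_def by (simp add: prod_sum_PiE)
  show ?thesis
  proof (cases "u = v")
    case True
    then show ?thesis unfolding eq by simp
  next
    case False
    then obtain i where i: "u i \<noteq> v i" by auto
    have "\<not> int M dvd (u i - v i)"
    proof
      assume "int M dvd (u i - v i)"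
      then have "int M \<le> \<bar>u i - v i\<bar>"
        using i by (simp add: zdvd_imp_le dvd_imp_le_int)
      then show False using bd[of i] M by linarith
    qed
    then have "(\<Sum>x<3 * M. cis (2 * pi * (of_int (u i - v i) * (real x / real M)))) = 0"
      using sum_roots_of_unity_eq_0[of M "u i - v i"] assms(1) by simp
    then show ?thesis unfolding eq using False by (auto intro!: prod_zero)
  qed
qed

lemma parseval_torus_grid:
  fixes U :: "('k::finite \<Rightarrow> int) set"
  assumes "M > 0" "finite U" and bd: "\<And>u i. u \<in> U \<Longrightarrow> \<bar>u i\<bar> \<le> Q" and M: "int M > 2 * Q"
  shows "(\<Sum>a\<in>torus_grid M. (cmod (\<Sum>u\<in>U. character M u a))\<^sup>2) = real ((3 * M) ^ CARD('k) * card U)"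
proof -
  have "complex_of_real (\<Sum>a\<in>torus_grid M. (cmod (\<Sum>u\<in>U. character M u a))\<^sup>2) =
      (\<Sum>a\<in>torus_grid M. \<Sum>u\<in>U. \<Sum>v\<in>U. character M u a * cnj (character M v a))"
    unfolding of_real_sum complex_norm_square cnj_sum sum_product ..
  also have "\<dots> = (\<Sum>u\<in>U. \<Sum>v\<in>U. \<Sum>a\<in>torus_grid M. character M u a * cnj (character M v a))"
    by (simp only: sum.swap [where A = "torus_grid M"])
  also have "\<dots> = (\<Sum>u\<in>U. \<Sum>v\<in>U. if u = v then of_nat ((3 * M) ^ CARD('k)) else 0)"
    by (intro sum.cong refl character_orthogonality[OF assms(1) _ _ M]) (use bd in auto)
  also have "\<dots> = complex_of_real (real ((3 * M) ^ CARD('k) * card U))"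
    using assms(2) by simp
  finally show ?thesis
    by (rule of_real_eq_iff [THEN iffD1])
qed

text \<open>
  The mean square of \<open>\<Sum>\<^sub>u e(u \<cdot> y)\<close> is \<open>card U\<close>, while at each point of \<open>G\<close> its modulus is at least
  \<open>card U / 2\<close>; so \<open>G\<close> occupies at most a fraction \<open>4 / card U\<close> of the grid.
\<close>

lemma card_mult_card_le_of_coherent:
  fixes U :: "('k::finite \<Rightarrow> int) set"
  assumes "M > 0" "finite U" and bd: "\<And>u i. u \<in> U \<Longrightarrow> \<bar>u i\<bar> \<le> Q" and M: "int M > 2 * Q"
    and G: "G \<subseteq> torus_grid M"
    and coh: "\<And>u a. u \<in> U \<Longrightarrow> a \<in> G \<Longrightarrow> Re (character M u a) \<ge> 1/2"
  shows "card U * card G \<le> 4 * (3 * M) ^ CARD('k)"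
proof (cases "U = {}")
  case False
  have finG: "finite G" using G finite_torus_grid finite_subset by blast
  have "(real (card U) / 2)\<^sup>2 \<le> (cmod (\<Sum>u\<in>U. character M u a))\<^sup>2" if "a \<in> G" for a
  proof -
    have "real (card U) / 2 = (\<Sum>u\<in>U. 1/2)" by simp
    also have "\<dots> \<le> (\<Sum>u\<in>U. Re (character M u a))"
      by (intro sum_mono coh that)
    also have "\<dots> \<le> cmod (\<Sum>u\<in>U. character M u a)"
      by (metis Re_sum complex_Re_le_cmod)
    finally show ?thesis by (intro power_mono) auto
  qed
  then have "real (card G) * (real (card U) / 2)\<^sup>2 \<le> (\<Sum>a\<in>G. (cmod (\<Sum>u\<in>U. character M u a))\<^sup>2)"
    using sum_mono[of G "\<lambda>_. (real (card U) / 2)\<^sup>2"] by simp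
  also have "\<dots> \<le> (\<Sum>a\<in>torus_grid M. (cmod (\<Sum>u\<in>U. character M u a))\<^sup>2)"
    by (intro sum_mono2 finite_torus_grid G) auto
  also have "\<dots> = real ((3 * M) ^ CARD('k)) * card U"
    using parseval_torus_grid[OF assms(1,2) _ M] bd by simp
  finally have "real (card G) * real (card U) * real (card U) \<le> 4 * real ((3 * M) ^ CARD('k)) * card U"
    by (simp add: power2_eq_square field_simps)
  moreover have "card U > 0" using False assms(2) by (simp add: card_gt_0_iff)
  ultimately have "real (card G) * real (card U) \<le> 4 * real ((3 * M) ^ CARD('k))"
    by (metis mult_le_cancel_right_pos of_nat_0_less_iff)
  then have "real (card U * card G) \<le> real (4 * (3 * M) ^ CARD('k))"
    by (simp add: mult.commute)
  then show ?thesis by (simp only: of_nat_le_iff)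
qed simp

lemma finite_bounded_int_functions: "finite {u :: 'k::finite \<Rightarrow> int. \<forall>i. \<bar>u i\<bar> \<le> Q}"
proof (rule finite_subset)
  show "{u :: 'k \<Rightarrow> int. \<forall>i. \<bar>u i\<bar> \<le> Q} \<subseteq> (\<Pi>\<^sub>E i\<in>UNIV. {-Q..Q})"
    by (force simp: abs_le_iff minus_le_iff)
  show "finite (\<Pi>\<^sub>E i\<in>(UNIV::'k set). {-Q..Q})" by (intro finite_PiE) auto
qed

text \<open>
  After scaling by \<open>M\<close> the interval has length \<open>2 r M \<ge> r M + 1\<close>, and an interval of length \<open>a\<close> contains
  at least \<open>a - 1\<close> integers.
\<close>

lemma card_nat_scaled_interval_ge:
  fixes t r :: real
  assumes "M > 0" "1 \<le> t" "0 < r" "r \<le> 1" "1 \<le> r * real M"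
  shows "finite {n::nat. \<bar>real n / real M - t\<bar> \<le> r}"
    and "r * real M \<le> real (card {n::nat. \<bar>real n / real M - t\<bar> \<le> r})"
proof -
  have iff: "\<bar>real n / real M - t\<bar> \<le> r \<longleftrightarrow> real M * (t - r) \<le> real n \<and> real n \<le> real M * (t + r)" for n
    using assms(1) by (simp add: abs_le_iff field_simps) linarith
  have nonneg: "0 \<le> real M * (t - r)" using assms by simp
  show fin: "finite {n::nat. \<bar>real n / real M - t\<bar> \<le> r}"
  proof (rule finite_subset)
    show "{n::nat. \<bar>real n / real M - t\<bar> \<le> r} \<subseteq> {..nat \<lfloor>real M * (t + r)\<rfloor>}"
      unfolding iff by (auto simp: le_nat_floor)
  qed simp
  let ?I = "{nat \<lceil>real M * (t - r)\<rceil>..nat \<lfloor>real M * (t + r)\<rfloor>}"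
  have hi: "real (nat \<lfloor>real M * (t + r)\<rfloor>) > real M * (t + r) - 1"
    by linarith
  have lo: "real (nat \<lceil>real M * (t - r)\<rceil>) < real M * (t - r) + 1"
    using nonneg by linarith
  have "?I \<subseteq> {n::nat. \<bar>real n / real M - t\<bar> \<le> r}"
  proof
    fix n assume n: "n \<in> ?I"
    then have "real M * (t - r) \<le> real n" by (simp add: nat_le_iff ceiling_le_iff)
    moreover have "0 \<le> real M * (t + r)" using assms by simp
    then have "real n \<le> real M * (t + r)"
      using n by (simp add: le_nat_iff le_floor_iff)
    ultimately show "n \<in> {n::nat. \<bar>real n / real M - t\<bar> \<le> r}" unfolding iff by simp
  qed
  then have "card ?I \<le> card {n::nat. \<bar>real n / real M - t\<bar> \<le> r}"
    using fin card_mono by blast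
  moreover have "real (card ?I) \<ge> r * real M"
  proof -
    have "real (card ?I) \<ge> real (nat \<lfloor>real M * (t + r)\<rfloor>) + 1 - real (nat \<lceil>real M * (t - r)\<rceil>)"
      by simp
    moreover have "real M * (t + r) - real M * (t - r) = 2 * (r * real M)"
      by (simp add: algebra_simps)
    ultimately show ?thesis using hi lo assms(5) by linarith
  qed
  ultimately show "r * real M \<le> real (card {n::nat. \<bar>real n / real M - t\<bar> \<le> r})"
    by linarith
qed

lemma cos_2pi_near_int_ge_half:
  fixes \<theta> :: real
  assumes "\<bar>\<theta> - of_int N\<bar> \<le> 1/8"
  shows "cos (2 * pi * \<theta>) \<ge> 1/2"
proof -
  define e where "e = \<theta> - of_int N"
  have "cos (2 * pi * \<theta>) = cos (2 * pi * e + 2 * pi * of_int N)"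
    by (simp add: e_def algebra_simps)
  also have "\<dots> = cos (2 * pi * e)"
    by (simp add: cos_add)
  also have "\<dots> = cos \<bar>2 * pi * e\<bar>" by simp
  also have "\<dots> \<ge> cos (pi / 3)"
  proof (rule cos_monotone_0_pi_le)
    have "\<bar>2 * pi * e\<bar> = 2 * pi * \<bar>e\<bar>" by (simp add: abs_mult)
    also have "\<dots> \<le> 2 * pi * (1/8)"
      using assms by (intro mult_left_mono) (auto simp: e_def)
    also have "\<dots> \<le> pi / 3" by simp
    finally show "\<bar>2 * pi * e\<bar> \<le> pi / 3" .
  qed auto
  finally show ?thesis by (simp add: cos_60)
qed

text \<open>
  The dual large sieve inequality behind the count of rational points.  Here \<open>u A\<close> is nearly integral
  for each \<open>u\<close> in \<open>U\<close>, and the points \<open>A s\<close> with \<open>0 \<le> s\<^sub>j < K\<close> are more than \<open>2 r\<close> apart modulo 1.  Since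
  \<open>u \<cdot> A s = u A \<cdot> s\<close>, all the waves \<open>e(u \<cdot> y)\<close> are in phase on the cubes of radius \<open>r\<close> round the points
  \<open>A s\<close>.  These \<open>K\<^sup>m\<close> cubes are disjoint, so they fill a proportion of about \<open>K\<^sup>m r\<^sup>k\<close> of the torus, and
  in-phase waves cannot do this unless they are few.
\<close>

lemma card_integer_vectors_near_kernel_le:
  fixes A :: "real ^ 'm::finite ^ 'k::finite"
  assumes "K \<ge> 1" "0 < r" "r \<le> 1"
    and sep: "\<And>s v. \<exists>j. s j \<noteq> 0 \<Longrightarrow> (\<And>j. \<bar>s j\<bar> \<le> int K) \<Longrightarrow>
        \<exists>i. 2 * r < \<bar>(\<Sum>j\<in>UNIV. A $ i $ j * of_int (s j)) - of_int (v i)\<bar>"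
    and bd: "\<And>u i. u \<in> U \<Longrightarrow> \<bar>u i\<bar> \<le> Q"
    and rQ: "r * of_int Q * real CARD('k) \<le> 1/16"
    and near: "\<And>u. u \<in> U \<Longrightarrow> \<exists>w. \<forall>j. \<bar>(\<Sum>i\<in>UNIV. of_int (u i) * A $ i $ j) - of_int (w j)\<bar>
        \<le> 1 / (16 * real CARD('m) * real K)"
  shows "real (card U) * real K ^ CARD('m) * r ^ CARD('k) \<le> 4 * 3 ^ CARD('k)"
proof (cases "U = {}")
  case True
  then show ?thesis by simp
next
  case False
  then have "Q \<ge> 0" using bd by fastforce
  have "finite U"
    by (rule finite_subset[OF _ finite_bounded_int_functions[of Q]]) (use bd in auto)
  obtain M :: nat where M: "int M > 2 * Q" "1 \<le> r * real M" "M > 0"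
  proof
    let ?M = "nat (2 * Q + 1) + nat \<lceil>1 / r\<rceil>"
    show "int ?M > 2 * Q" "?M > 0" using \<open>Q \<ge> 0\<close> by linarith+
    have "1 / r \<le> real ?M" by linarith
    then show "1 \<le> r * real ?M" using assms(2) by (simp add: field_simps)
  qed
  \<comment> \<open>Representatives of the points \<open>A s\<close> modulo 1 in the middle period of the grid.\<close>
  define x where "x s i = frac (\<Sum>j\<in>UNIV. A $ i $ j * real (s j)) + 1" for s :: "'m \<Rightarrow> nat" and i
  define B where "B s = (\<Pi>\<^sub>E i\<in>UNIV. {n. \<bar>real n / real M - x s i\<bar> \<le> r})" for s
  define S where "S = (\<Pi>\<^sub>E j\<in>(UNIV::'m set). {..<K})"
  have x1: "1 \<le> x s i" "x s i < 2" for s i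
    unfolding x_def using frac_lt_1[of "\<Sum>j\<in>UNIV. A $ i $ j * real (s j)"] by auto
  have mem_B: "\<bar>real (a i) / real M - x s i\<bar> \<le> r" if "a \<in> B s" for a s i
    using that by (auto simp: B_def)
  have finB: "finite (B s)" for s
    unfolding B_def using x1 assms M by (intro finite_PiE card_nat_scaled_interval_ge) auto
  have cardB: "(r * real M) ^ CARD('k) \<le> real (card (B s))" for s
  proof -
    have "(r * real M) ^ CARD('k) = (\<Prod>i\<in>(UNIV::'k set). r * real M)" by simp
    also have "\<dots> \<le> (\<Prod>i\<in>(UNIV::'k set). real (card {n. \<bar>real n / real M - x s i\<bar> \<le> r}))"
      using x1 assms M by (intro prod_mono conjI card_nat_scaled_interval_ge) auto
    finally show ?thesis by (simp add: B_def card_PiE)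
  qed
  have finS: "finite S" unfolding S_def by (intro finite_PiE) auto
  have cardS: "card S = K ^ CARD('m)" unfolding S_def by (simp add: card_PiE)
  have disj: "B s \<inter> B s' = {}" if s: "s \<in> S" "s' \<in> S" "s \<noteq> s'" for s s'
  proof (rule ccontr)
    assume "B s \<inter> B s' \<noteq> {}"
    then obtain a where a: "a \<in> B s" "a \<in> B s'" by blast
    define d where "d j = int (s j) - int (s' j)" for j
    define v where "v i = \<lfloor>\<Sum>j\<in>UNIV. A $ i $ j * real (s j)\<rfloor> - \<lfloor>\<Sum>j\<in>UNIV. A $ i $ j * real (s' j)\<rfloor>" for i
    have "\<exists>j. d j \<noteq> 0" using s(3) by (auto simp: d_def fun_eq_iff)
    moreover have "\<bar>d j\<bar> \<le> int K" for j
    proof -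
      have "s j < K" "s' j < K" using s by (auto simp: S_def)
      then show ?thesis by (simp add: d_def)
    qed
    ultimately obtain i where "2 * r < \<bar>(\<Sum>j\<in>UNIV. A $ i $ j * of_int (d j)) - of_int (v i)\<bar>"
      using sep[of d v] by blast
    moreover have "(\<Sum>j\<in>UNIV. A $ i $ j * of_int (d j)) - of_int (v i) = x s i - x s' i"
      by (simp add: d_def v_def x_def frac_def algebra_simps sum_subtractf)
    moreover have "\<bar>x s i - x s' i\<bar> \<le> 2 * r"
      using mem_B[OF a(1), of i] mem_B[OF a(2), of i] by linarith
    ultimately show False by linarith
  qed
  define G where "G = (\<Union>s\<in>S. B s)"
  have Ggrid: "G \<subseteq> torus_grid M"
  proof
    fix a assume "a \<in> G"
    then obtain s where a: "a \<in> B s" by (auto simp: G_def)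
    have "a i < 3 * M" for i
    proof -
      have "real (a i) / real M < 3"
        using mem_B[OF a, of i] x1(2)[of s i] assms(3) by linarith
      then have "real (a i) < real (3 * M)" using M(3) by (simp add: field_simps)
      then show ?thesis by linarith
    qed
    then show "a \<in> torus_grid M" by (auto simp: torus_grid_def)
  qed
  have coh: "Re (character M u a) \<ge> 1/2" if u: "u \<in> U" and "a \<in> G" for u a
  proof -
    obtain s where s: "s \<in> S" "a \<in> B s" using \<open>a \<in> G\<close> by (auto simp: G_def)
    obtain w where w: "\<And>j. \<bar>(\<Sum>i\<in>UNIV. of_int (u i) * A $ i $ j) - of_int (w j)\<bar>
        \<le> 1 / (16 * real CARD('m) * real K)"
      using near[OF u] by blast
    \<comment> \<open>The phase is an integer \<open>N\<close>, up to \<open>e1\<close> from moving inside the cube and \<open>e2\<close> from \<open>u A\<close>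
      not being exactly integral.\<close>
    define e1 where "e1 = (\<Sum>i\<in>UNIV. of_int (u i) * (real (a i) / real M - x s i))"
    define e2 where "e2 = (\<Sum>j\<in>UNIV. real (s j) * ((\<Sum>i\<in>UNIV. of_int (u i) * A $ i $ j) - of_int (w j)))"
    define N where "N = (\<Sum>j\<in>UNIV. int (s j) * w j)
       + (\<Sum>i\<in>UNIV. u i * (1 - \<lfloor>\<Sum>j\<in>UNIV. A $ i $ j * real (s j)\<rfloor>))"
    have e1: "\<bar>e1\<bar> \<le> 1/16"
    proof -
      have "\<bar>e1\<bar> \<le> (\<Sum>i\<in>(UNIV::'k set). of_int Q * r)"
        unfolding e1_def
      proof (rule order_trans[OF sum_abs], rule sum_mono)
        fix i
        have "\<bar>real_of_int (u i)\<bar> \<le> of_int Q" using bd[OF u, of i] by linarith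
        then show "\<bar>of_int (u i) * (real (a i) / real M - x s i)\<bar> \<le> of_int Q * r"
          unfolding abs_mult using mem_B[OF s(2), of i] by (intro mult_mono) auto
      qed
      then show ?thesis using rQ by (simp add: mult_ac)
    qed
    have e2: "\<bar>e2\<bar> \<le> 1/16"
    proof -
      have "\<bar>e2\<bar> \<le> (\<Sum>j\<in>(UNIV::'m set). real K * (1 / (16 * real CARD('m) * real K)))"
        unfolding e2_def
      proof (rule order_trans[OF sum_abs], rule sum_mono)
        fix j
        have "s j < K" using s by (auto simp: S_def)
        then show "\<bar>real (s j) * ((\<Sum>i\<in>UNIV. of_int (u i) * A $ i $ j) - of_int (w j))\<bar>
            \<le> real K * (1 / (16 * real CARD('m) * real K))"
          unfolding abs_mult using w[of j] by (intro mult_mono) auto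
      qed
      also have "\<dots> = 1/16" using assms(1) by simp
      finally show ?thesis .
    qed
    have "(\<Sum>j\<in>UNIV. real (s j) * (\<Sum>i\<in>UNIV. of_int (u i) * A $ i $ j))
        = (\<Sum>i\<in>UNIV. of_int (u i) * (\<Sum>j\<in>UNIV. A $ i $ j * real (s j)))"
      unfolding sum_distrib_left by (subst sum.swap) (simp add: mult_ac)
    then have "(\<Sum>i\<in>UNIV. of_int (u i) * (real (a i) / real M)) = e1 + e2 + of_int N"
      unfolding e1_def e2_def N_def x_def frac_def
      by (simp add: algebra_simps sum.distrib sum_subtractf)
    then have "\<bar>(\<Sum>i\<in>UNIV. of_int (u i) * (real (a i) / real M)) - of_int N\<bar> \<le> 1/8"
      using e1 e2 by linarith
    then show ?thesis
      unfolding character_def by (simp only: cis.simps cos_2pi_near_int_ge_half)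
  qed
  have "real K ^ CARD('m) * (r * real M) ^ CARD('k) = (\<Sum>s\<in>S. (r * real M) ^ CARD('k))"
    using cardS by simp
  also have "\<dots> \<le> (\<Sum>s\<in>S. real (card (B s)))"
    by (intro sum_mono cardB)
  also have "\<dots> = real (card G)"
    unfolding G_def by (subst card_UN_disjoint) (use finS finB disj in auto)
  finally have "real (card U) * (real K ^ CARD('m) * (r * real M) ^ CARD('k)) \<le> real (card U * card G)"
    by (simp add: mult_left_mono)
  also have "\<dots> \<le> real (4 * (3 * M) ^ CARD('k))"
    using card_mult_card_le_of_coherent[OF M(3) \<open>finite U\<close> _ M(1) Ggrid coh] bd
    by (simp only: of_nat_le_iff)
  finally have "(real (card U) * real K ^ CARD('m) * r ^ CARD('k)) * real M ^ CARD('k)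
      \<le> (4 * 3 ^ CARD('k)) * real M ^ CARD('k)"
    by (simp add: power_mult_distrib mult_ac)
  then show ?thesis using M(3) by simp
qed

section \<open>Distance to the integers and the exponent of a matrix\<close>

lemma infnorm_attained: "\<exists>i. infnorm (x :: real ^ 'n::finite) = \<bar>x $ i\<bar>"
proof -
  have "infnorm x \<in> (\<lambda>i. \<bar>x \<bullet> i\<bar>) ` Basis"
    unfolding infnorm_Max by (intro Max_in) auto
  then show ?thesis by (auto simp: Basis_vec_def inner_axis)
qed

lemma vec_of_ints_in_integer_vectors: "(\<chi> i. real_of_int (k i)) \<in> integer_vectors"
  by (simp add: integer_vectors_def)

lemma integer_vectorsE:
  assumes "k \<in> integer_vectors"
  obtains z where "k = (\<chi> i. real_of_int (z i))"
proof
  show "k = (\<chi> i. real_of_int \<lfloor>k $ i\<rfloor>)"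
    using assms by (auto simp: integer_vectors_def vec_eq_iff)
qed

lemma dist_int_le: "k \<in> integer_vectors \<Longrightarrow> dist_int y \<le> infnorm (y - k)"
  unfolding dist_int_def by (rule cINF_lower) (auto intro!: bdd_belowI2[where m=0] simp: infnorm_pos_le)

lemma integer_vectors_nonempty: "integer_vectors \<noteq> {}"
  using vec_of_ints_in_integer_vectors by blast

lemma dist_int_nonneg: "0 \<le> dist_int y"
  unfolding dist_int_def
  by (rule cINF_greatest[OF integer_vectors_nonempty]) (simp add: infnorm_pos_le)

lemma dist_int_less_iff:
  fixes y :: "real ^ 'n::finite"
  shows "dist_int y < e \<longleftrightarrow> (\<exists>k :: 'n \<Rightarrow> int. \<forall>i. \<bar>y $ i - of_int (k i)\<bar> < e)"
proof
  assume "dist_int y < e"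
  then obtain k where k: "k \<in> integer_vectors" "infnorm (y - k) < e"
    unfolding dist_int_def
    by (subst (asm) cINF_less_iff)
      (auto intro!: bdd_belowI2[where m=0] simp: infnorm_pos_le integer_vectors_nonempty)
  obtain z where z: "k = (\<chi> i. real_of_int (z i))" using k(1) by (rule integer_vectorsE)
  have "\<bar>y $ i - of_int (z i)\<bar> < e" for i
    using component_le_infnorm_cart[of "y - k" i] k(2) by (simp add: z)
  then show "\<exists>k :: 'n \<Rightarrow> int. \<forall>i. \<bar>y $ i - of_int (k i)\<bar> < e" by blast
next
  assume "\<exists>k :: 'n \<Rightarrow> int. \<forall>i. \<bar>y $ i - of_int (k i)\<bar> < e"
  then obtain k :: "'n \<Rightarrow> int" where k: "\<And>i. \<bar>y $ i - of_int (k i)\<bar> < e" by blast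
  have "infnorm (y - (\<chi> i. real_of_int (k i))) < e"
    using infnorm_attained[of "y - (\<chi> i. real_of_int (k i))"] k by auto
  then show "dist_int y < e"
    using dist_int_le[OF vec_of_ints_in_integer_vectors[of k], of y] by linarith
qed

text \<open>
  Multiples of integer vectors are integer vectors.  This gives infinitely many solutions as soon as
  there is one exact solution, both for \<open>A s\<close> and for \<open>q y\<close>.
\<close>

lemma dist_int_scale_eq_0:
  fixes y :: "real ^ 'n::finite"
  assumes "dist_int y = 0"
  shows "dist_int (real c *\<^sub>R y) = 0"
proof -
  have "dist_int (real c *\<^sub>R y) < e" if "e > 0" for e
  proof -
    have "dist_int y < e / (real c + 1)" using that assms by simp
    then obtain k :: "'n \<Rightarrow> int" where k: "\<And>i. \<bar>y $ i - of_int (k i)\<bar> < e / (real c + 1)"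
      unfolding dist_int_less_iff by blast
    have "\<bar>(real c *\<^sub>R y) $ i - of_int (int c * k i)\<bar> < e" for i
    proof -
      have "\<bar>(real c *\<^sub>R y) $ i - of_int (int c * k i)\<bar> = real c * \<bar>y $ i - of_int (k i)\<bar>"
        by (simp add: abs_mult flip: right_diff_distrib)
      also have "\<dots> \<le> real c * (e / (real c + 1))"
        by (rule mult_left_mono[OF less_imp_le[OF k]]) simp
      also have "\<dots> < e" using that by (simp add: field_simps)
      finally show ?thesis .
    qed
    then show ?thesis unfolding dist_int_less_iff
      by (intro exI[of _ "\<lambda>i. int c * k i"]) blast
  qed
  then show ?thesis
    using dist_int_nonneg[of "real c *\<^sub>R y"] by (metis less_irrefl order_le_less)
qed

text \<open>
  Only finitely many \<open>s\<close> violate \<open>\<parallel>A s\<parallel> \<ge> |s|\<^bsup>-w\<^esup>\<close>, and none of them has \<open>\<parallel>A s\<parallel> = 0\<close>, because all its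
  multiples would violate it as well.  The constant \<open>c\<close> absorbs these finitely many exceptions.
\<close>

lemma exponent_bound_imp_separation:
  fixes A :: "real ^ 'm::finite ^ 'k::finite"
  assumes om: "dioph_exponent A \<le> ereal b" and w: "b < w" "0 < w"
  shows "\<exists>c>0. \<forall>K::nat. \<forall>s v. 1 \<le> K \<and> (\<exists>j. s j \<noteq> 0) \<and> (\<forall>j. \<bar>s j\<bar> \<le> int K) \<longrightarrow>
     (\<exists>i. c * real K powr (- w) \<le> \<bar>(\<Sum>j\<in>UNIV. A $ i $ j * of_int (s j)) - of_int (v i :: int)\<bar>)"
proof -
  define D where "D = {q \<in> integer_vectors. dist_int (A *v q) < infnorm q powr (- w)}"
  have finD: "finite D"
  proof (rule ccontr)
    assume "infinite D"
    then have "ereal w \<le> dioph_exponent A"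
      unfolding dioph_exponent_def D_def by (intro SUP_upper) auto
    then have "ereal w \<le> ereal b" using om order_trans by blast
    then show False using w(1) by simp
  qed
  have pos: "dist_int (A *v q) > 0" if q: "q \<in> integer_vectors" "q \<noteq> 0" for q
  proof (rule ccontr)
    assume "\<not> dist_int (A *v q) > 0"
    then have z: "dist_int (A *v q) = 0" using dist_int_nonneg[of "A *v q"] by linarith
    have "(\<lambda>c::nat. real c *\<^sub>R q) ` {1..} \<subseteq> D"
    proof (rule image_subsetI)
      fix c :: nat assume "c \<in> {1..}"
      moreover have "real c *\<^sub>R q \<in> integer_vectors"
        using q(1) by (auto simp: integer_vectors_def)
      moreover have "dist_int (A *v (real c *\<^sub>R q)) = 0"
        using dist_int_scale_eq_0[OF z, of c] by (simp add: matrix_vector_mult_scaleR)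
      moreover have "infnorm (real c *\<^sub>R q) > 0"
        using q(2) \<open>c \<in> {1..}\<close> by (simp add: infnorm_pos_lt)
      ultimately show "real c *\<^sub>R q \<in> D" by (simp add: D_def)
    qed
    moreover have "inj_on (\<lambda>c::nat. real c *\<^sub>R q) {1..}"
      using q(2) by (auto simp: inj_on_def)
    ultimately have "finite {1::nat..}"
      using finD finite_imageD finite_subset by blast
    then show False by (simp add: infinite_Ici)
  qed
  have D0: "q \<noteq> 0" if "q \<in> D" for q
    using that dist_int_nonneg[of "A *v q"] by (auto simp: D_def infnorm_0)
  define c where "c = Min (insert 1 ((\<lambda>q. dist_int (A *v q)) ` D))"
  have "c > 0"
    unfolding c_def using finD pos D0 by (subst Min_gr_iff) (auto simp: D_def)
  have c1: "c \<le> 1" and cD: "q \<in> D \<Longrightarrow> c \<le> dist_int (A *v q)" for q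
    unfolding c_def using finD by (auto intro!: Min_le)
  show ?thesis
  proof (intro exI[of _ c] conjI allI impI \<open>c > 0\<close>)
    fix K :: nat and s :: "'m \<Rightarrow> int" and v :: "'k \<Rightarrow> int"
    assume a: "1 \<le> K \<and> (\<exists>j. s j \<noteq> 0) \<and> (\<forall>j. \<bar>s j\<bar> \<le> int K)"
    define q :: "real ^ 'm" where "q = (\<chi> j. of_int (s j))"
    have qi: "q \<in> integer_vectors" and q0: "q \<noteq> 0"
      using a by (auto simp: q_def vec_of_ints_in_integer_vectors vec_eq_iff)
    have "infnorm q \<le> real K"
    proof -
      obtain j where "infnorm q = \<bar>q $ j\<bar>" using infnorm_attained by blast
      moreover have "\<bar>real_of_int (s j)\<bar> \<le> real K"
        using a by (metis of_int_abs of_int_le_iff of_int_of_nat_eq)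
      ultimately show ?thesis by (simp add: q_def)
    qed
    have Kw: "real K powr (- w) \<le> 1" using a w(2) by (simp add: powr_le_one_le ge_one_powr_ge_zero powr_minus field_simps)
    have "c * real K powr (- w) \<le> dist_int (A *v q)"
    proof (cases "q \<in> D")
      case True
      have "c * real K powr (- w) \<le> c" using Kw \<open>c > 0\<close> by simp
      then show ?thesis using cD[OF True] by linarith
    next
      case False
      have "c * real K powr (- w) \<le> 1 * real K powr (- w)"
        by (intro mult_right_mono c1) auto
      also have "\<dots> \<le> infnorm q powr (- w)"
        using \<open>infnorm q \<le> real K\<close> q0 w(2) by (simp add: powr_mono2' infnorm_pos_lt)
      also have "\<dots> \<le> dist_int (A *v q)" using False qi by (simp add: D_def)
      finally show ?thesis .
    qed
    also have "\<dots> \<le> infnorm (A *v q - (\<chi> i. of_int (v i)))"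
      by (intro dist_int_le vec_of_ints_in_integer_vectors)
    finally show "\<exists>i. c * real K powr (- w) \<le> \<bar>(\<Sum>j\<in>UNIV. A $ i $ j * of_int (s j)) - of_int (v i)\<bar>"
      using infnorm_attained[of "A *v q - (\<chi> i. of_int (v i))"]
      by (auto simp: matrix_vector_mult_def q_def)
  qed
qed

section \<open>Approximable points of the chart form a null set\<close>

definition affine_chart :: "real ^ 'm ^ ('d option) \<Rightarrow> real ^ 'd \<Rightarrow> real ^ ('d::finite + 'm::finite)" where
  "affine_chart A x = concat_vec x (prepend_one x v* A)"

lemma sum_UNIV_option: "(\<Sum>i\<in>(UNIV :: 'd::finite option set). f i) = f None + (\<Sum>i\<in>UNIV. f (Some i))"
  unfolding UNIV_option_conv by (simp add: sum.reindex)

lemma sum_UNIV_Plus: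
  fixes f :: "'d::finite + 'm::finite \<Rightarrow> real"
  shows "(\<Sum>k\<in>UNIV. f k) = (\<Sum>i\<in>UNIV. f (Inl i)) + (\<Sum>j\<in>UNIV. f (Inr j))"
  by (simp add: UNIV_Plus_UNIV[symmetric] sum.Plus del: UNIV_Plus_UNIV)

lemma affine_chart_Inl [simp]: "affine_chart A x $ Inl i = x $ i"
  by (simp add: affine_chart_def concat_vec_def)

lemma affine_chart_Inr [simp]:
  "affine_chart A x $ Inr j = A $ None $ j + (\<Sum>i\<in>UNIV. x $ i * A $ Some i $ j)"
  by (simp add: affine_chart_def concat_vec_def vector_matrix_mult_def prepend_one_def
      sum_UNIV_option mult.commute)

text \<open>
  The integer vector nearest to \<open>q \<phi>(x)\<close> splits into \<open>p\<close>, near \<open>q x\<close>, and \<open>w\<close>, near \<open>q (1, x) A\<close>.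
  Replacing \<open>q x\<close> by \<open>p\<close> in the second condition changes each coordinate by at most the first error
  times a column sum of \<open>A\<close>.
\<close>

lemma rational_point_of_approximation:
  fixes A :: "real ^ 'm::finite ^ ('d::finite option)" and x :: "real ^ 'd"
  assumes "0 \<le> \<tau>" "0 < q" and near: "dist_int (real q *\<^sub>R affine_chart A x) < real q powr (- \<tau>)"
    and R: "\<And>i. \<bar>x $ i\<bar> \<le> real R"
  shows "\<exists>u :: 'd option \<Rightarrow> int. u None = int q \<and> (\<forall>i. \<bar>u i\<bar> \<le> (int R + 1) * int q) \<and>
     (\<forall>i. \<bar>x $ i - of_int (u (Some i)) / real q\<bar> \<le> real q powr (- \<tau> - 1)) \<and>
     (\<exists>w :: 'm \<Rightarrow> int. \<forall>j. \<bar>(\<Sum>i\<in>UNIV. of_int (u i) * A $ i $ j) - of_int (w j)\<bar>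
        \<le> (1 + (\<Sum>j\<in>UNIV. \<Sum>i\<in>UNIV. \<bar>A $ Some i $ j\<bar>)) * real q powr (- \<tau>))"
proof -
  let ?e = "real q powr (- \<tau>)"
  obtain k :: "'d + 'm \<Rightarrow> int" where k: "\<And>i. \<bar>(real q *\<^sub>R affine_chart A x) $ i - of_int (k i)\<bar> < ?e"
    using near unfolding dist_int_less_iff by blast
  define u where "u = (\<lambda>i. case i of None \<Rightarrow> int q | Some i \<Rightarrow> k (Inl i))"
  have p: "\<bar>real q * x $ i - of_int (u (Some i))\<bar> < ?e" for i
    using k[of "Inl i"] by (simp add: u_def)
  have e1: "?e \<le> 1" using assms by (simp add: powr_minus ge_one_powr_ge_zero inverse_le_1_iff)
  have "\<bar>u i\<bar> \<le> (int R + 1) * int q" for i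
  proof (cases i)
    case None
    then show ?thesis by (simp add: u_def algebra_simps)
  next
    case (Some i')
    have "\<bar>real_of_int (u (Some i'))\<bar> \<le> \<bar>real q * x $ i'\<bar> + 1"
      using p[of i'] e1 by linarith
    also have "\<dots> \<le> real q * real R + 1"
      using R[of i'] by (simp add: abs_mult mult_left_mono)
    also have "\<dots> \<le> (real R + 1) * real q"
      using assms(2) by (simp add: algebra_simps)
    finally have "real_of_int \<bar>u i\<bar> \<le> real_of_int ((int R + 1) * int q)" by (simp add: Some)
    then show ?thesis by (simp only: of_int_le_iff)
  qed
  moreover have "\<bar>x $ i - of_int (u (Some i)) / real q\<bar> \<le> real q powr (- \<tau> - 1)" for i
  proof -
    have "\<bar>x $ i - of_int (u (Some i)) / real q\<bar> = \<bar>real q * x $ i - of_int (u (Some i))\<bar> / real q"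
      using assms(2) by (simp add: field_simps abs_if)
    also have "\<dots> \<le> ?e / real q"
      using p[of i] by (intro divide_right_mono) auto
    also have "\<dots> = real q powr (- \<tau> - 1)"
      using assms(2) by (simp add: powr_diff)
    finally show ?thesis .
  qed
  moreover have "\<bar>(\<Sum>i\<in>UNIV. of_int (u i) * A $ i $ j) - of_int (k (Inr j))\<bar>
        \<le> (1 + (\<Sum>j\<in>UNIV. \<Sum>i\<in>UNIV. \<bar>A $ Some i $ j\<bar>)) * ?e" for j
  proof -
    have "(\<Sum>i\<in>UNIV. of_int (u i) * A $ i $ j) - of_int (k (Inr j))
        = ((real q *\<^sub>R affine_chart A x) $ Inr j - of_int (k (Inr j)))
          - (\<Sum>i\<in>UNIV. (real q * x $ i - of_int (u (Some i))) * A $ Some i $ j)"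
      by (simp add: sum_UNIV_option u_def algebra_simps sum_subtractf sum_distrib_left)
    moreover have "\<bar>\<Sum>i\<in>UNIV. (real q * x $ i - of_int (u (Some i))) * A $ Some i $ j\<bar>
        \<le> (\<Sum>i\<in>UNIV. ?e * \<bar>A $ Some i $ j\<bar>)"
      by (rule order_trans[OF sum_abs], rule sum_mono)
        (unfold abs_mult, intro mult_right_mono less_imp_le[OF p], simp)
    moreover have "(\<Sum>i\<in>UNIV. ?e * \<bar>A $ Some i $ j\<bar>) \<le> ?e * (\<Sum>j\<in>UNIV. \<Sum>i\<in>UNIV. \<bar>A $ Some i $ j\<bar>)"
      unfolding sum_distrib_left[symmetric]
      by (intro mult_left_mono member_le_sum) (auto intro: sum_nonneg)
    moreover have "\<bar>(real q *\<^sub>R affine_chart A x) $ Inr j - of_int (k (Inr j))\<bar> \<le> ?e"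
      using k[of "Inr j"] by linarith
    ultimately have "\<bar>(\<Sum>i\<in>UNIV. of_int (u i) * A $ i $ j) - of_int (k (Inr j))\<bar>
        \<le> ?e + ?e * (\<Sum>j\<in>UNIV. \<Sum>i\<in>UNIV. \<bar>A $ Some i $ j\<bar>)" by linarith
    then show ?thesis by (simp add: algebra_simps)
  qed
  moreover have "u None = int q" by (simp add: u_def)
  ultimately show ?thesis
    by (intro exI[of _ u] exI[of _ "\<lambda>j. k (Inr j)"] conjI allI)
qed

lemma measure_cube:
  fixes c :: "real ^ 'd::finite"
  assumes "0 \<le> \<rho>"
  shows "measure lborel (cbox (\<chi> i. c $ i - \<rho>) (\<chi> i. c $ i + \<rho>)) = (2 * \<rho>) ^ CARD('d)"
proof -
  have "cbox (\<chi> i. c $ i - \<rho>) (\<chi> i. c $ i + \<rho>) \<noteq> {}"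
    using assms by (auto simp: interval_ne_empty_cart)
  then show ?thesis by (simp add: content_cbox_cart)
qed

text \<open>
  Borel--Cantelli on dyadic blocks.  Block \<open>t\<close> takes care of the denominators from \<open>2\<^bsup>nt\<^esup>\<close> up to \<open>2\<^bsup>n(t+1)\<^esup>\<close>
  and uses \<open>K = 2\<^sup>t\<close>.  Since \<open>n \<tau> > 1\<close>, the requirement that \<open>u A\<close> be within \<open>1 / (16 m K)\<close> of the integers
  is eventually weaker than the one satisfied by the rational points of interest; counting with this
  weaker condition keeps the loss from \<open>w > n\<close> arbitrarily small, while the size of the cubes still
  gains a factor \<open>2\<^bsup>-td(n\<tau>-1)\<^esup>\<close>.
\<close>

lemma bounded_chart_approximable_null:
  fixes A :: "real ^ 'm::finite ^ ('d::finite option)"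
  assumes om: "dioph_exponent A \<le> ereal (real (CARD('d) + CARD('m)))"
    and tau: "\<tau> > 1 / real (CARD('d) + CARD('m))"
  shows "\<exists>N\<in>null_sets lborel. \<forall>x. (\<forall>i. \<bar>x $ i\<bar> \<le> real R) \<and> affine_chart A x \<in> approximable \<tau> \<longrightarrow> x \<in> N"
proof -
  define d m n k where "d = CARD('d)" and "m = CARD('m)" and "n = d + m" and "k = CARD('d option)"
  have kd: "k = d + 1" by (simp add: k_def d_def)
  have d0: "d > 0" and m0: "m > 0" and n0: "n > 0" by (auto simp: d_def m_def n_def)
  have "\<tau> > 0" using tau by (smt (verit) divide_nonneg_nonneg of_nat_0_le_iff)
  have nt: "real n * \<tau> > 1"
    using tau n0 unfolding n_def d_def m_def by (simp only: pos_divide_less_eq of_nat_0_less_iff mult.commute)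
  define \<sigma> where "\<sigma> = real d * (real n * \<tau> - 1) / 2"
  have s0: "\<sigma> > 0" using nt d0 by (simp add: \<sigma>_def)
  \<comment> \<open>Half of the gain \<open>d (n \<tau> - 1)\<close> pays for the factor \<open>2\<^bsup>tk(w-n)\<^esup>\<close> lost in the count.\<close>
  define w where "w = real n + \<sigma> / real k"
  have w: "w > real n" "w > 0" using s0 n0 kd by (auto simp: w_def intro!: add_pos_pos)
  have expo: "- (real m) + w * real k - real n * (\<tau> + 1) * real d = - \<sigma>"
    unfolding w_def \<sigma>_def kd n_def using d0 by (simp add: field_simps)
  obtain c where c: "c > 0" and sep: "\<And>K s v. 1 \<le> (K::nat) \<Longrightarrow> (\<exists>j. s j \<noteq> 0) \<Longrightarrow> (\<forall>j. \<bar>s j\<bar> \<le> int K) \<Longrightarrow>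
     (\<exists>i. c * real K powr (- w) \<le> \<bar>(\<Sum>j\<in>UNIV. A $ i $ j * of_int (s j)) - of_int (v i :: int)\<bar>)"
    using exponent_bound_imp_separation[of A "real n" w] om w unfolding n_def d_def m_def by blast
  define c' where "c' = min 1 (min (c / 3) (1 / (16 * real k * (real R + 1) * 2 ^ n)))"
  have c': "c' > 0" "c' \<le> 1" "c' \<le> c / 3" "c' \<le> 1 / (16 * real k * (real R + 1) * 2 ^ n)"
    using c kd unfolding c'_def by auto
  define r where "r t = c' * (2 ^ t) powr (- w)" for t :: nat
  define \<rho> where "\<rho> t = (2 ^ t) powr (- (real n * (\<tau> + 1)))" for t :: nat
  define Q where "Q t = (int R + 1) * 2 ^ (n * (t + 1))" for t :: nat
  define U :: "nat \<Rightarrow> ('d option \<Rightarrow> int) set" where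
    "U t = {u. u None > 0 \<and> (\<forall>i. \<bar>u i\<bar> \<le> Q t) \<and>
       (\<exists>w. \<forall>j. \<bar>(\<Sum>i\<in>UNIV. of_int (u i) * A $ i $ j) - of_int (w j)\<bar> \<le> 1 / (16 * real CARD('m) * real (2 ^ t)))}" for t
  define box where "box t u = cbox (\<chi> i. of_int (u (Some i)) / of_int (u None) - \<rho> t)
      (\<chi> i. of_int (u (Some i)) / of_int (u None) + \<rho> t)" for t and u :: "'d option \<Rightarrow> int"
  define E where "E t = (\<Union>u\<in>U t. box t u)" for t
  have finU: "finite (U t)" for t
    by (rule finite_subset[OF _ finite_bounded_int_functions[of "Q t"]]) (auto simp: U_def)
  have r0: "0 < r t" and \<rho>0: "0 < \<rho> t" for t using c' by (auto simp: r_def \<rho>_def)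
  have pw1: "(2 ^ t :: real) powr (- w) \<le> 1" for t
    using w(2) by (simp add: powr_minus ge_one_powr_ge_zero inverse_le_1_iff)
  have cardU: "real (card (U t)) * real (2 ^ t) ^ m * r t ^ k \<le> 4 * 3 ^ k" for t
    unfolding m_def k_def
  proof (rule card_integer_vectors_near_kernel_le[where Q = "Q t"])
    show "1 \<le> (2::nat) ^ t" by simp
    show "0 < r t" by (rule r0)
    show "r t \<le> 1" unfolding r_def using c' pw1[of t] by (intro mult_le_one) auto
    show "\<exists>i. 2 * r t < \<bar>(\<Sum>j\<in>UNIV. A $ i $ j * of_int (s j)) - of_int (v i)\<bar>"
      if s: "\<exists>j. s j \<noteq> 0" "\<And>j. \<bar>s j\<bar> \<le> int (2 ^ t)" for s :: "'m \<Rightarrow> int" and v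
    proof -
      obtain i where "c * real (2 ^ t) powr (- w) \<le> \<bar>(\<Sum>j\<in>UNIV. A $ i $ j * of_int (s j)) - of_int (v i)\<bar>"
        using sep[of "2 ^ t" s v] s by auto
      moreover have "2 * r t < c * real (2 ^ t) powr (- w)"
        unfolding r_def using c' c by (simp add: mult_strict_right_mono)
      ultimately show ?thesis by (intro exI[of _ i]) linarith
    qed
    show "\<bar>u i\<bar> \<le> Q t" if "u \<in> U t" for u i using that by (auto simp: U_def)
    show "r t * of_int (Q t) * real CARD('d option) \<le> 1 / 16"
    proof -
      have "(2 ^ t :: real) powr (- w) \<le> (2 ^ t) powr (- real n)"
        using w by (intro powr_mono) auto
      also have "\<dots> = 1 / 2 ^ (n * t)"
        by (simp add: powr_minus powr_realpow divide_inverse mult.commute flip: power_mult)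
      finally have "r t \<le> (1 / (16 * real k * (real R + 1) * 2 ^ n)) * (1 / 2 ^ (n * t))"
        unfolding r_def using c' by (intro mult_mono) auto
      then have "r t * (of_int (Q t) * real k)
          \<le> (1 / (16 * real k * (real R + 1) * 2 ^ n)) * (1 / 2 ^ (n * t)) * (of_int (Q t) * real k)"
        by (intro mult_right_mono) (auto simp: Q_def)
      also have "\<dots> = 1 / 16"
      proof -
        define R' where "R' = real R + 1"
        have "R' > 0" "k > 0" using kd by (auto simp: R'_def)
        moreover have "real_of_int (Q t) = R' * (2 ^ n * 2 ^ (n * t))"
          by (simp add: Q_def R'_def power_add)
        ultimately show ?thesis unfolding R'_def[symmetric] by (simp add: field_simps)
      qed
      finally show ?thesis by (simp add: k_def mult.assoc)
    qed
    show "\<exists>w. \<forall>j. \<bar>(\<Sum>i\<in>UNIV. of_int (u i) * A $ i $ j) - of_int (w j)\<bar>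
        \<le> 1 / (16 * real CARD('m) * real (2 ^ t))" if "u \<in> U t" for u
      using that by (auto simp: U_def)
  qed
  define D where "D = 4 * 3 ^ k * 2 ^ d / c' ^ k"
  have meas: "measure lborel (E t) \<le> D * (2 powr (- \<sigma>)) ^ t" for t
  proof -
    define b :: real where "b = 2 ^ t"
    have b0: "b > 0" by (simp add: b_def)
    have "measure lborel (E t) \<le> (\<Sum>u\<in>U t. measure lborel (box t u))"
      unfolding E_def using finU by (intro measure_UNION_le) (auto simp: box_def)
    also have "\<dots> = real (card (U t)) * (2 * \<rho> t) ^ d"
    proof -
      have "measure lborel (box t u) = (2 * \<rho> t) ^ d" for u
        using measure_cube[of "\<rho> t" "\<chi> i. of_int (u (Some i)) / of_int (u None)"] \<rho>0[of t]
        by (simp add: box_def d_def)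
      then show ?thesis by simp
    qed
    also have "\<dots> \<le> 4 * 3 ^ k / (b ^ m * r t ^ k) * (2 * \<rho> t) ^ d"
    proof (rule mult_right_mono)
      show "real (card (U t)) \<le> 4 * 3 ^ k / (b ^ m * r t ^ k)"
        using cardU[of t] b0 r0[of t] by (simp add: b_def field_simps)
    qed (use \<rho>0[of t] in auto)
    also have "\<dots> = D * (\<rho> t ^ d / (b ^ m * (b powr (- w)) ^ k))"
      by (simp add: D_def r_def b_def power_mult_distrib field_simps)
    also have "\<rho> t ^ d / (b ^ m * (b powr (- w)) ^ k) = b powr (- \<sigma>)"
    proof -
      have "\<rho> t ^ d = b powr (- (real n * (\<tau> + 1)) * real d)"
        using b0 by (simp add: \<rho>_def b_def powr_powr mult_ac flip: powr_realpow)
      moreover have "(b powr (- w)) ^ k = b powr (- w * real k)"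
        using b0 by (simp add: powr_powr flip: powr_realpow)
      moreover have "b ^ m = b powr real m" using b0 by (simp add: powr_realpow)
      ultimately have "\<rho> t ^ d / (b ^ m * (b powr (- w)) ^ k)
          = b powr (- (real n * (\<tau> + 1)) * real d - (real m + - w * real k))"
        by (simp only: powr_diff powr_add)
      also have "- (real n * (\<tau> + 1)) * real d - (real m + - w * real k) = - \<sigma>"
        using expo by (simp add: algebra_simps)
      finally show ?thesis .
    qed
    also have "b powr (- \<sigma>) = (2 powr (- \<sigma>)) ^ t"
      by (simp add: b_def powr_powr mult.commute flip: powr_realpow)
    finally show ?thesis .
  qed
  have setsE: "E t \<in> sets lborel" for t
    unfolding E_def box_def using finU by (intro sets.finite_UN) auto
  have "limsup E \<in> null_sets lborel"
  proof (rule borel_cantelli_limsup1[OF setsE])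
    show "emeasure lborel (E t) < \<infinity>" for t
      unfolding E_def box_def using finU
      by (intro emeasure_bounded_finite) auto
    have "2 powr (- \<sigma>) < (1::real)" using s0 by (simp add: powr_less_one)
    then have "summable (\<lambda>t. D * (2 powr (- \<sigma>)) ^ t)"
      by (intro summable_mult summable_geometric) auto
    then show "summable (\<lambda>t. measure lborel (E t))"
      by (rule summable_comparison_test') (use meas in auto)
  qed
  moreover have "x \<in> limsup E" if bd: "\<forall>i. \<bar>x $ i\<bar> \<le> real R" and ap: "affine_chart A x \<in> approximable \<tau>" for x
  proof -
    define C where "C = 1 + (\<Sum>j\<in>UNIV. \<Sum>i\<in>UNIV. \<bar>A $ Some i $ j\<bar>)"
    have "C > 0" unfolding C_def by (intro add_pos_nonneg sum_nonneg) auto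
    have "(2::real) powr (real n * \<tau> - 1) > 1" using nt by simp
    then obtain t0 where t0: "C * (16 * real m) < (2 powr (real n * \<tau> - 1)) ^ t0"
      using real_arch_pow by blast
    have "\<exists>t\<ge>t1. x \<in> E t" for t1
    proof -
      let ?S = "{q :: nat. q > 0 \<and> dist_int (real q *\<^sub>R affine_chart A x) < real q powr (- \<tau>)}"
      have "infinite ?S" using ap by (simp add: approximable_def)
      then obtain q where q: "q > 0" "dist_int (real q *\<^sub>R affine_chart A x) < real q powr (- \<tau>)"
        and qbig: "q \<ge> (2 ^ n) ^ max t0 t1"
        by (metis (mono_tags, lifting) infinite_nat_iff_unbounded_le mem_Collect_eq)
      obtain t where t: "(2 ^ n) ^ t \<le> q" "q < (2 ^ n) ^ (t + 1)"
        using ex_power_ivl1[of "2 ^ n" q] q(1) n0 by (metis One_nat_def Suc_leI numeral_2_eq_2 one_less_numeral_iff one_less_power semiring_norm(76))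
      have "max t0 t1 < t + 1"
      proof -
        have "((2::nat) ^ n) ^ max t0 t1 < (2 ^ n) ^ (t + 1)" using qbig t(2) by linarith
        then show ?thesis using n0 by (simp only: power_strict_increasing_iff one_less_power one_less_numeral_iff semiring_norm(76))
      qed
      then have tt: "t0 \<le> t" "t1 \<le> t" by auto
      have qlo: "(2 ^ t) powr real n \<le> real q"
      proof -
        have "(2 ^ t :: real) powr real n = real ((2 ^ n) ^ t)"
          by (simp add: powr_realpow mult.commute flip: power_mult)
        also have "\<dots> \<le> real q" using t(1) by (simp only: of_nat_le_iff)
        finally show ?thesis .
      qed
      obtain u :: "'d option \<Rightarrow> int" where u: "u None = int q" "\<forall>i. \<bar>u i\<bar> \<le> (int R + 1) * int q"
          "\<forall>i. \<bar>x $ i - of_int (u (Some i)) / real q\<bar> \<le> real q powr (- \<tau> - 1)"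
        and "\<exists>w :: 'm \<Rightarrow> int. \<forall>j. \<bar>(\<Sum>i\<in>UNIV. of_int (u i) * A $ i $ j) - of_int (w j)\<bar> \<le> C * real q powr (- \<tau>)"
        using rational_point_of_approximation[OF _ q, of R] \<open>\<tau> > 0\<close> bd unfolding C_def by auto
      then obtain w' :: "'m \<Rightarrow> int" where
        w': "\<And>j. \<bar>(\<Sum>i\<in>UNIV. of_int (u i) * A $ i $ j) - of_int (w' j)\<bar> \<le> C * real q powr (- \<tau>)" by blast
      have lo: "real q powr (- s) \<le> (2 ^ t) powr (- (real n * s))" if "s \<ge> 0" for s
      proof -
        have "real q powr (- s) \<le> ((2 ^ t) powr real n) powr (- s)"
          using qlo that by (intro powr_mono2') auto
        then show ?thesis by (simp add: powr_powr)
      qed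
      have small: "C * real q powr (- \<tau>) \<le> 1 / (16 * real CARD('m) * real (2 ^ t))"
      proof -
        have "C * (16 * real m) \<le> (2 powr (real n * \<tau> - 1)) ^ t"
          by (rule order_trans[OF less_imp_le[OF t0] power_increasing[OF tt(1)]]) (intro ge_one_powr_ge_zero; use nt in linarith)
        also have "\<dots> = (2 ^ t) powr (real n * \<tau> - 1)"
          by (simp add: powr_powr mult.commute flip: powr_realpow)
        also have "\<dots> = (2 ^ t) powr (real n * \<tau>) / 2 ^ t" by (simp add: powr_diff)
        finally have "C * (16 * real m) * (2 ^ t) powr (- (real n * \<tau>))
            \<le> (2 ^ t) powr (real n * \<tau>) / 2 ^ t * (2 ^ t) powr (- (real n * \<tau>))"
          by (intro mult_right_mono) auto
        also have "\<dots> = 1 / 2 ^ t" by (simp add: powr_minus)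
        finally have "C * (2 ^ t) powr (- (real n * \<tau>)) \<le> 1 / (16 * real m * 2 ^ t)"
          using m0 by (simp add: field_simps)
        moreover have "C * real q powr (- \<tau>) \<le> C * (2 ^ t) powr (- (real n * \<tau>))"
          using lo[of \<tau>] \<open>\<tau> > 0\<close> \<open>C > 0\<close> by (intro mult_left_mono) auto
        ultimately show ?thesis by (simp add: m_def)
      qed
      have "u \<in> U t"
      proof -
        have "\<bar>u i\<bar> \<le> Q t" for i
        proof -
          have "int q \<le> (2 ^ n) ^ (t + 1)" using t(2) by (metis less_imp_le of_nat_le_iff of_nat_numeral of_nat_power)
          then have "(int R + 1) * int q \<le> Q t"
            unfolding Q_def power_mult by (intro mult_left_mono) auto
          then show ?thesis using u(2) order_trans by blast
        qed
        moreover have "\<exists>w. \<forall>j. \<bar>(\<Sum>i\<in>UNIV. of_int (u i) * A $ i $ j) - of_int (w j)\<bar> \<le> 1 / (16 * real CARD('m) * real (2 ^ t))"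
          using w' small order_trans by blast
        ultimately show ?thesis using u(1) q(1) by (simp add: U_def)
      qed
      moreover have "x \<in> box t u"
      proof -
        have "\<bar>x $ i - of_int (u (Some i)) / of_int (u None)\<bar> \<le> \<rho> t" for i
          using u(1,3) lo[of "\<tau> + 1"] \<open>\<tau> > 0\<close> unfolding \<rho>_def
          by (metis (no_types, opaque_lifting) add_nonneg_nonneg diff_conv_add_uminus less_imp_le minus_add_distrib of_int_of_nat_eq order_trans zero_le_one)
        then show ?thesis by (auto simp: box_def mem_box_cart abs_le_iff algebra_simps)
      qed
      ultimately show ?thesis using tt by (auto simp: E_def)
    qed
    then show ?thesis by (auto simp: limsup_INF_SUP)
  qed
  ultimately show ?thesis by blast
qed

lemma chart_approximable_null:
  fixes A :: "real ^ 'm::finite ^ ('d::finite option)"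
  assumes om: "dioph_exponent A \<le> ereal (real (CARD('d) + CARD('m)))"
    and tau: "\<tau> > 1 / real (CARD('d) + CARD('m))"
  shows "\<exists>N\<in>null_sets lborel. \<forall>x. affine_chart A x \<in> approximable \<tau> \<longrightarrow> x \<in> N"
proof -
  obtain N where N: "\<And>R. N R \<in> null_sets lborel"
    and sub: "\<And>R x. (\<forall>i. \<bar>x $ i\<bar> \<le> real R) \<Longrightarrow> affine_chart A x \<in> approximable \<tau> \<Longrightarrow> x \<in> N R"
    using bounded_chart_approximable_null[OF assms] by metis
  have "(\<Union>R. N R) \<in> null_sets lborel" using N by (intro null_sets_UN) auto
  moreover have "x \<in> (\<Union>R. N R)" if "affine_chart A x \<in> approximable \<tau>" for x
  proof -
    have "\<bar>x $ i\<bar> \<le> real (nat \<lceil>norm x\<rceil>)" for i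
      using component_le_norm_cart[of x i] by linarith
    then show ?thesis using sub that by blast
  qed
  ultimately show ?thesis by blast
qed

section \<open>The chart as a parametrization and the null direction\<close>

definition chart_linear :: "real ^ 'm ^ ('d option) \<Rightarrow> real ^ 'd \<Rightarrow> real ^ ('d::finite + 'm::finite)" where
  "chart_linear A h = concat_vec h (\<chi> j. \<Sum>i\<in>UNIV. h $ i * A $ Some i $ j)"

lemma chart_linear_Inl [simp]: "chart_linear A h $ Inl i = h $ i"
  by (simp add: chart_linear_def concat_vec_def)

lemma chart_linear_Inr [simp]: "chart_linear A h $ Inr j = (\<Sum>i\<in>UNIV. h $ i * A $ Some i $ j)"
  by (simp add: chart_linear_def concat_vec_def)

lemma vec_sum_eq_iff:
  "(x :: 'a ^ ('d::finite + 'm::finite)) = y \<longleftrightarrow> (\<forall>i. x $ Inl i = y $ Inl i) \<and> (\<forall>j. x $ Inr j = y $ Inr j)"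
  unfolding vec_eq_iff by (metis sumE)

lemma linear_chart_linear: "linear (chart_linear A)"
  by (rule linearI)
    (simp_all add: vec_sum_eq_iff sum.distrib sum_distrib_left algebra_simps)

lemma affine_chart_eq: "affine_chart A x = affine_chart A 0 + chart_linear A x"
  by (simp add: vec_sum_eq_iff)

lemma affine_chart_has_derivative: "(affine_chart A has_derivative chart_linear A) (at x)"
proof -
  have "(chart_linear A has_derivative chart_linear A) (at x)"
    using linear_chart_linear linear_conv_bounded_linear bounded_linear_imp_has_derivative by blast
  then have "((\<lambda>x. affine_chart A 0 + chart_linear A x) has_derivative chart_linear A) (at x)"
    by (auto intro!: derivative_eq_intros)
  then show ?thesis by (simp flip: affine_chart_eq)
qed

lemma jacobian_affine_chart: "jacobian (affine_chart A) (at x) = matrix (chart_linear A)"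
  unfolding jacobian_def using frechet_derivative_at[OF affine_chart_has_derivative] by metis

lemma affine_graph_eq_range: "affine_graph A = range (affine_chart A)"
  by (auto simp: affine_graph_def affine_chart_def)

lemma local_parametrization_affine_chart:
  fixes A :: "real ^ 'm::finite ^ ('d::finite option)"
  shows "local_parametrization (affine_graph A) UNIV (affine_chart A)"
proof -
  have "inj ((*v) (matrix (chart_linear A)))"
  proof (rule injI)
    fix x y :: "real ^ 'd"
    assume "matrix (chart_linear A) *v x = matrix (chart_linear A) *v y"
    then have "chart_linear A x = chart_linear A y"
      using matrix_works[of "chart_linear A"] linear_chart_linear[of A] linear_matrix_vector_mul_eq[of "chart_linear A"] by metis
    then show "x = y" by (simp add: vec_sum_eq_iff vec_eq_iff)
  qed
  moreover have "homeomorphism UNIV (range (affine_chart A)) (affine_chart A) (\<lambda>y. \<chi> i. y $ Inl i)"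
  proof (rule homeomorphismI)
    show "continuous_on UNIV (affine_chart A)"
      by (intro continuous_at_imp_continuous_on ballI has_derivative_continuous[OF affine_chart_has_derivative])
    show "continuous_on (range (affine_chart A)) (\<lambda>y. \<chi> i. y $ Inl i)"
      by (intro continuous_on_vec_lambda continuous_intros)
  qed (auto simp: vec_eq_iff)
  ultimately show ?thesis
    unfolding local_parametrization_def jacobian_affine_chart affine_graph_eq_range
    using affine_chart_has_derivative by (auto simp: differentiable_def)
qed

lemma submanifold_affine_graph:
  fixes A :: "real ^ 'm::finite ^ ('d::finite option)"
  shows "submanifold TYPE('d) (affine_graph A)"
  unfolding submanifold_def using local_parametrization_affine_chart[of A]
  by (metis affine_graph_eq_range)

text \<open>
  The single piece \<open>\<phi>(N)\<close>, repeated, is a cover of total volume 0.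
\<close>

lemma induced_measure_chart_null:
  fixes A :: "real ^ 'm::finite ^ ('d::finite option)"
  assumes N: "N \<in> null_sets lborel" and E: "E \<subseteq> affine_chart A ` N"
  shows "induced_measure TYPE('d) (affine_graph A) E = 0"
proof -
  have "(\<Sum>k::nat. \<integral>\<^sup>+ x\<in>N. ennreal (volume_density (affine_chart A) x) \<partial>lborel) = 0"
    using N by (simp add: nn_integral_null_set)
  moreover have "induced_measure TYPE('d) (affine_graph A) E
      \<le> (\<Sum>k::nat. \<integral>\<^sup>+ x\<in>N. ennreal (volume_density (affine_chart A) x) \<partial>lborel)"
    unfolding induced_measure_def
  proof (rule Inf_lower, rule CollectI, intro exI conjI)
    show "\<forall>k::nat. local_parametrization (affine_graph A) ((\<lambda>_. UNIV) k) ((\<lambda>_. affine_chart A) k) \<and>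
        (\<lambda>_. N) k \<in> sets borel \<and> (\<lambda>_. N) k \<subseteq> (\<lambda>_. UNIV) k"
      using local_parametrization_affine_chart N by (auto simp: null_sets_def)
  qed (use E in auto)
  ultimately show ?thesis by simp
qed

lemma extremal_if_exponent_le:
  fixes A :: "real ^ 'm::finite ^ ('d::finite option)"
  assumes "dioph_exponent A \<le> ereal (real (CARD('d) + CARD('m)))"
  shows "extremal TYPE('d) (affine_graph A)"
  unfolding extremal_def
proof (intro conjI allI impI)
  show "submanifold TYPE('d) (affine_graph A)" by (rule submanifold_affine_graph)
  fix \<tau> assume "1 / real CARD('d + 'm) < \<tau>"
  then have "1 / real (CARD('d) + CARD('m)) < \<tau>" by simp
  from chart_approximable_null[OF assms this] obtain N where N: "N \<in> null_sets lborel"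
      "\<And>x. affine_chart A x \<in> approximable \<tau> \<Longrightarrow> x \<in> N"
    by blast
  show "induced_measure TYPE('d) (affine_graph A) (approximable \<tau> \<inter> affine_graph A) = 0"
    by (rule induced_measure_chart_null[OF N(1)]) (use N(2) in \<open>auto simp: affine_graph_eq_range\<close>)
qed

section \<open>Images of Borel sets under differentiable maps\<close>

text \<open>
  A copy of a finite type that carries a well-order.  The inequality between the measure of an image
  and the integral of the Jacobian determinant is known for vectors indexed by a well-ordered type;
  relabelling the coordinates by this copy carries it over to an arbitrary finite index type.
\<close>

typedef ('a::finite) enumerated = "UNIV :: 'a set" ..

lemma bij_Rep_enumerated: "bij Rep_enumerated"
  by (metis Abs_enumerated_inverse Rep_enumerated_inverse UNIV_I bijI')

instance enumerated :: (finite) finite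
proof
  show "finite (UNIV :: 'a enumerated set)"
    using bij_betw_finite[OF bij_Rep_enumerated [where 'a = 'a]] by simp
qed

definition enumerated_index :: "'a::finite enumerated \<Rightarrow> nat" where
  "enumerated_index = (SOME f. inj f)"

lemma inj_enumerated_index: "inj enumerated_index"
  unfolding enumerated_index_def
  using finite_imp_inj_to_nat_seg[of "UNIV :: 'a enumerated set"] by (metis (mono_tags, lifting) finite someI)

instantiation enumerated :: (finite) wellorder
begin

definition less_eq_enumerated :: "'a enumerated \<Rightarrow> 'a enumerated \<Rightarrow> bool" where
  "x \<le> y \<longleftrightarrow> enumerated_index x \<le> enumerated_index y"

definition less_enumerated :: "'a enumerated \<Rightarrow> 'a enumerated \<Rightarrow> bool" where
  "x < y \<longleftrightarrow> enumerated_index x < enumerated_index y"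

instance
proof
  fix x y z :: "'a enumerated" and P :: "'a enumerated \<Rightarrow> bool"
  show "x < y \<longleftrightarrow> x \<le> y \<and> \<not> y \<le> x" "x \<le> x" "x \<le> y \<or> y \<le> x"
    "x \<le> y \<Longrightarrow> y \<le> z \<Longrightarrow> x \<le> z"
    by (auto simp: less_eq_enumerated_def less_enumerated_def)
  show "x \<le> y \<Longrightarrow> y \<le> x \<Longrightarrow> x = y"
    using inj_enumerated_index by (auto simp: less_eq_enumerated_def inj_def)
  show "P x" if "\<And>x. (\<And>y. y < x \<Longrightarrow> P y) \<Longrightarrow> P x"
    using that unfolding less_enumerated_def by (rule measure_induct_rule)
qed

end

definition reindex_vec :: "real ^ 'a \<Rightarrow> real ^ ('a::finite enumerated)" where
  "reindex_vec x = (\<chi> i. x $ Rep_enumerated i)"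

definition unindex_vec :: "real ^ ('a::finite enumerated) \<Rightarrow> real ^ 'a" where
  "unindex_vec y = (\<chi> i. y $ Abs_enumerated i)"

lemma unindex_reindex [simp]: "unindex_vec (reindex_vec x) = x"
  by (simp add: unindex_vec_def reindex_vec_def vec_eq_iff Abs_enumerated_inverse)

lemma linear_reindex_vec: "linear reindex_vec"
  by (rule linearI) (simp_all add: reindex_vec_def vec_eq_iff)

lemma linear_unindex_vec: "linear unindex_vec"
  by (rule linearI) (simp_all add: unindex_vec_def vec_eq_iff)

lemma borel_reindex_vec [measurable]: "reindex_vec \<in> borel_measurable borel"
  and borel_unindex_vec [measurable]: "unindex_vec \<in> borel_measurable borel"
  using linear_reindex_vec linear_unindex_vec
  by (auto simp: linear_conv_bounded_linear intro!: borel_measurable_continuous_onI linear_continuous_on)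

lemma emeasure_lborel_box_cart:
  fixes l u :: "real ^ 'a::finite"
  assumes "\<And>i. l $ i \<le> u $ i"
  shows "emeasure lborel (box l u) = (\<Prod>i\<in>UNIV. u $ i - l $ i)"
proof -
  have "cbox l u \<noteq> {}" using assms by (simp add: interval_ne_empty_cart)
  then have "measure lborel (cbox l u) = (\<Prod>i\<in>UNIV. u $ i - l $ i)" by (rule content_cbox_cart)
  moreover have "emeasure lborel (box l u) = emeasure lborel (cbox l u)"
    by (simp add: emeasure_lborel_box_eq emeasure_lborel_cbox_eq)
  moreover have "emeasure lborel (cbox l u) = ennreal (measure lborel (cbox l u))"
    by (intro emeasure_eq_ennreal_measure) (simp add: emeasure_lborel_cbox_eq)
  ultimately show ?thesis by simp
qed

text \<open>
  Relabelling coordinates maps boxes to boxes with the same side lengths.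
\<close>

lemma distr_lborel_reindex_vec:
  "distr lborel borel (reindex_vec :: real ^ 'a::finite \<Rightarrow> _) = lborel"
proof (rule lborel_eqI[symmetric])
  fix l u :: "real ^ 'a enumerated"
  assume le: "\<And>b. b \<in> Basis \<Longrightarrow> l \<bullet> b \<le> u \<bullet> b"
  have le': "l $ i \<le> u $ i" for i
    using le[of "axis i 1"] by (simp add: inner_axis)
  have "reindex_vec -` box l u = box (unindex_vec l) (unindex_vec u)"
    unfolding set_eq_iff mem_box_cart vimage_eq reindex_vec_def unindex_vec_def
    by simp (metis Rep_enumerated_inverse Abs_enumerated_inverse UNIV_I)
  then have "emeasure (distr lborel borel reindex_vec) (box l u)
      = emeasure lborel (box (unindex_vec l) (unindex_vec u :: real ^ 'a))"
    by (subst emeasure_distr) auto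
  also have "\<dots> = (\<Prod>i\<in>(UNIV::'a set). u $ Abs_enumerated i - l $ Abs_enumerated i)"
    by (subst emeasure_lborel_box_cart) (auto simp: unindex_vec_def le')
  also have "(\<Prod>i\<in>(UNIV::'a set). u $ Abs_enumerated i - l $ Abs_enumerated i) = (\<Prod>i\<in>UNIV. u $ i - l $ i)"
    by (rule prod.reindex_bij_witness[where i = Rep_enumerated and j = Abs_enumerated])
      (auto simp: Abs_enumerated_inverse Rep_enumerated_inverse)
  also have "ennreal (\<Prod>i\<in>UNIV. u $ i - l $ i) = emeasure lborel (box l u)"
    by (subst emeasure_lborel_box_cart) (auto simp: le')
  also have "\<dots> = (\<Prod>b\<in>Basis. (u - l) \<bullet> b)"
    by (rule emeasure_lborel_box) (rule le)
  finally show "emeasure (distr lborel borel reindex_vec) (box l u) = (\<Prod>b\<in>Basis. (u - l) \<bullet> b)" .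
qed simp

text \<open>
  Conjugating the permutations in the Leibniz formula by the relabelling preserves their signs.
\<close>

lemma det_reindex:
  fixes A :: "real ^ 'a::finite ^ 'a"
  shows "det (\<chi> i j. A $ Rep_enumerated i $ Rep_enumerated j) = det A"
proof -
  let ?f = "Rep_enumerated :: 'a enumerated \<Rightarrow> 'a" and ?g = "Abs_enumerated :: 'a \<Rightarrow> 'a enumerated"
  have bf: "bij_betw ?f UNIV UNIV" by (rule bij_Rep_enumerated)
  have bg: "bij_betw ?g UNIV UNIV"
    by (metis Abs_enumerated_inverse Rep_enumerated_inverse UNIV_I bijI')
  have prd: "(\<Prod>i\<in>UNIV. A $ ?f i $ ?f (p i)) = (\<Prod>i\<in>UNIV. A $ i $ map_permutation UNIV ?f p i)"
    if "p permutes UNIV" for p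
  proof (rule prod.reindex_bij_witness[where i = ?g and j = ?f])
    fix i :: "'a enumerated"
    show "A $ ?f i $ map_permutation UNIV ?f p (?f i) = A $ ?f i $ ?f (p i)"
      using bf by (subst map_permutation_apply) (auto simp: bij_def)
  qed (auto simp: Abs_enumerated_inverse Rep_enumerated_inverse)
  have "(\<Sum>p\<in>{p. p permutes UNIV}. of_int (sign p) * (\<Prod>i\<in>UNIV. A $ ?f i $ ?f (p i)))
      = (\<Sum>p\<in>{p. p permutes UNIV}. of_int (sign p) * (\<Prod>i\<in>UNIV. A $ i $ p i))"
  proof (rule sum.reindex_bij_witness[where i = "map_permutation UNIV ?g" and j = "map_permutation UNIV ?f"])
    fix p :: "'a enumerated \<Rightarrow> 'a enumerated" assume p: "p \<in> {p. p permutes UNIV}"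
    show "map_permutation UNIV ?g (map_permutation UNIV ?f p) = p"
      by (rule map_permutation_compose_inv[OF bf]) (use p in \<open>auto simp: Rep_enumerated_inverse\<close>)
    show "map_permutation UNIV ?f p \<in> {p. p permutes UNIV}"
      using map_permutation_permutes[OF bf] p by simp
    show "of_int (sign (map_permutation UNIV ?f p)) * (\<Prod>i\<in>UNIV. A $ i $ map_permutation UNIV ?f p i)
        = of_int (sign p) * (\<Prod>i\<in>UNIV. A $ ?f i $ ?f (p i))"
      using p bf by (subst sign_map_permutation) (auto simp: prd bij_def)
  next
    fix p :: "'a \<Rightarrow> 'a" assume p: "p \<in> {p. p permutes UNIV}"
    show "map_permutation UNIV ?f (map_permutation UNIV ?g p) = p"
      by (rule map_permutation_compose_inv[OF bg]) (use p in \<open>auto simp: Abs_enumerated_inverse\<close>)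
    show "map_permutation UNIV ?g p \<in> {p. p permutes UNIV}"
      using map_permutation_permutes[OF bg] p by simp
  qed
  then show ?thesis by (simp add: det_def)
qed

lemma borel_cover_of_image_wellorder:
  fixes g :: "real ^ 'n::{finite,wellorder} \<Rightarrow> real ^ 'n::_"
  assumes B: "B \<in> sets borel"
    and der: "\<And>x. x \<in> B \<Longrightarrow> (g has_derivative g' x) (at x within B)"
    and meas: "(\<lambda>x. indicator B x * \<bar>det (matrix (g' x))\<bar>) \<in> borel_measurable borel"
    and r: "(\<integral>\<^sup>+x. ennreal (indicator B x * \<bar>det (matrix (g' x))\<bar>) \<partial>lborel) = ennreal r" "0 \<le> r"
  shows "\<exists>T\<in>sets borel. g ` B \<subseteq> T \<and> emeasure lborel T \<le> ennreal r"
proof -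
  have "((\<lambda>x. indicator B x * \<bar>det (matrix (g' x))\<bar>) has_integral r) UNIV"
    by (rule nn_integral_has_integral[OF meas _ r]) auto
  moreover have "(\<lambda>x. indicator B x * \<bar>det (matrix (g' x))\<bar>) = (\<lambda>x. if x \<in> B then \<bar>det (matrix (g' x))\<bar> else 0)"
    by (auto simp: indicator_def)
  ultimately have hi: "((\<lambda>x. \<bar>det (matrix (g' x))\<bar>) has_integral r) B"
    by (simp add: has_integral_restrict_UNIV)
  have Bl: "B \<in> sets lebesgue" using B by simp
  have int: "(\<lambda>x. \<bar>det (matrix (g' x))\<bar>) integrable_on B" using hi by blast
  have lm: "g ` B \<in> lmeasurable" by (rule measurable_differentiable_image[OF Bl der int])
  have "measure lebesgue (g ` B) \<le> r"
    using measure_differentiable_image[OF Bl der int] integral_unique[OF hi] by simp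
  then have "emeasure lebesgue (g ` B) \<le> ennreal r"
    using lm by (simp add: emeasure_eq_measure2 ennreal_leI)
  then show ?thesis
    using completion_upper[of "g ` B" lborel] lm by (metis fmeasurableD sets_lborel)
qed

text \<open>
  The image of a Borel set need not be Borel, hence the Borel superset \<open>T\<close>.  The integral is allowed to
  be infinite, in which case \<open>T = UNIV\<close> will do.
\<close>

lemma borel_cover_of_image:
  fixes g :: "real ^ 'n::finite \<Rightarrow> real ^ 'n"
  assumes B: "B \<in> sets borel"
    and der: "\<And>x. x \<in> B \<Longrightarrow> (g has_derivative ((*v) (J x))) (at x within B)"
    and meas: "(\<lambda>x. indicator B x * \<bar>det (J x)\<bar>) \<in> borel_measurable borel"
  shows "\<exists>T\<in>sets borel. g ` B \<subseteq> T \<and>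
    emeasure lborel T \<le> (\<integral>\<^sup>+x. ennreal (indicator B x * \<bar>det (J x)\<bar>) \<partial>lborel)"
proof (cases "(\<integral>\<^sup>+x. ennreal (indicator B x * \<bar>det (J x)\<bar>) \<partial>lborel)" rule: ennreal_cases)
  case (real r)
  define B' where "B' = unindex_vec -` B"
  define h where "h = reindex_vec \<circ> g \<circ> unindex_vec"
  define h' where "h' y = reindex_vec \<circ> ((*v) (J (unindex_vec y))) \<circ> unindex_vec" for y
  have B': "B' \<in> sets borel"
    using measurable_sets[OF borel_unindex_vec B] by (simp add: B'_def)
  have der': "(h has_derivative h' y) (at y within B')" if "y \<in> B'" for y
  proof -
    have 1: "(unindex_vec has_derivative unindex_vec) (at y within B')"
      using linear_unindex_vec linear_conv_bounded_linear bounded_linear_imp_has_derivative by blast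
    have "unindex_vec ` B' = B" unfolding B'_def
      by (auto simp: image_iff) (metis unindex_reindex)
    then have 2: "(g has_derivative ((*v) (J (unindex_vec y)))) (at (unindex_vec y) within unindex_vec ` B')"
      using der[of "unindex_vec y"] that by (simp add: B'_def)
    have 3: "(reindex_vec has_derivative reindex_vec)
        (at ((g \<circ> unindex_vec) y) within (g \<circ> unindex_vec) ` B')"
      using linear_reindex_vec linear_conv_bounded_linear bounded_linear_imp_has_derivative by blast
    from diff_chain_within[OF diff_chain_within[OF 1 2] 3]
    show ?thesis unfolding h_def h'_def by (simp only: o_assoc)
  qed
  have det': "det (matrix (h' y)) = det (J (unindex_vec y))" for y
  proof -
    have "matrix (h' y) = (\<chi> i j. J (unindex_vec y) $ Rep_enumerated i $ Rep_enumerated j)"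
    proof -
      have ax: "unindex_vec (axis j 1) = axis (Rep_enumerated j) 1" for j :: "'n enumerated"
        by (auto simp: unindex_vec_def axis_def vec_eq_iff Rep_enumerated_inverse Abs_enumerated_inverse)
      then show ?thesis
        by (simp add: matrix_def h'_def reindex_vec_def ax matrix_vector_mult_basis column_def)
    qed
    then show ?thesis by (simp add: det_reindex)
  qed
  have fn: "indicator B' y * \<bar>det (matrix (h' y))\<bar> = indicator B (unindex_vec y) * \<bar>det (J (unindex_vec y))\<bar>" for y
    by (auto simp: det' B'_def indicator_def)
  have "(\<integral>\<^sup>+y. ennreal (indicator B' y * \<bar>det (matrix (h' y))\<bar>) \<partial>lborel)
      = (\<integral>\<^sup>+y. ennreal (indicator B (unindex_vec y) * \<bar>det (J (unindex_vec y))\<bar>) \<partial>distr lborel borel reindex_vec)"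
    by (simp only: fn distr_lborel_reindex_vec)
  also have "\<dots> = (\<integral>\<^sup>+x. ennreal (indicator B x * \<bar>det (J x)\<bar>) \<partial>lborel)"
    using measurable_compose[OF borel_unindex_vec meas] by (subst nn_integral_distr) auto
  finally have r': "(\<integral>\<^sup>+y. ennreal (indicator B' y * \<bar>det (matrix (h' y))\<bar>) \<partial>lborel) = ennreal r"
    using real by simp
  have meas': "(\<lambda>y. indicator B' y * \<bar>det (matrix (h' y))\<bar>) \<in> borel_measurable borel"
    unfolding fn by (rule measurable_compose[OF borel_unindex_vec meas])
  obtain T where T: "T \<in> sets borel" "h ` B' \<subseteq> T" "emeasure lborel T \<le> ennreal r"
    using borel_cover_of_image_wellorder[OF B' der' meas' r' real(1)] by blast
  have "emeasure lborel (reindex_vec -` T) = emeasure lborel T"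
    using T(1) by (subst distr_lborel_reindex_vec[symmetric], subst emeasure_distr) auto
  moreover have "g ` B \<subseteq> reindex_vec -` T"
  proof (rule image_subsetI)
    fix x assume "x \<in> B"
    then have "h (reindex_vec x) \<in> T" using T(2) by (auto simp: B'_def)
    then show "g x \<in> reindex_vec -` T" by (simp add: h_def)
  qed
  moreover have "reindex_vec -` T \<in> sets borel"
    using measurable_sets[OF borel_reindex_vec T(1)] by simp
  ultimately show ?thesis using T(3) real by (intro bexI[of _ "reindex_vec -` T"]) auto
qed (auto intro!: bexI[of _ UNIV])

section \<open>Volume on an affine graph\<close>

definition slope :: "real ^ 'm ^ ('d option) \<Rightarrow> real ^ 'm ^ 'd::finite" where
  "slope A = (\<chi> i. A $ Some i)"

text \<open>
  The Gram matrix of the linear part \<open>h \<mapsto> (h, h B)\<close> of the chart, where \<open>B\<close> is \<open>A\<close> without the row of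
  the constant coordinate 1.
\<close>

definition gram :: "real ^ 'm ^ ('d option) \<Rightarrow> real ^ 'd ^ 'd::finite" where
  "gram A = mat 1 + slope A ** transpose (slope A)"

text \<open>
  Each matrix \<open>1 + t B B\<^sup>T\<close> with \<open>t \<ge> 0\<close> is positive definite, hence nonsingular; so its determinant
  keeps the sign it has at \<open>t = 0\<close>.
\<close>

lemma det_mat_1_plus_gram_pos:
  fixes B :: "real ^ 'm::finite ^ 'd::finite"
  shows "0 < det (mat 1 + B ** transpose B)"
proof -
  define S where "S t = mat 1 + t *\<^sub>R (B ** transpose B)" for t
  have nz: "det (S t) \<noteq> 0" if t: "0 \<le> t" for t
  proof -
    have "x = 0" if "S t *v x = 0" for x
    proof -
      have "0 = x \<bullet> (S t *v x)" using that by simp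
      also have "\<dots> = x \<bullet> x + t * (x \<bullet> (B *v (transpose B *v x)))"
        by (simp add: S_def matrix_vector_mult_add_rdistrib inner_add_right matrix_vector_mul_assoc
            scaleR_matrix_vector_assoc[symmetric] del: transpose_matrix_vector)
      also have "x \<bullet> (B *v (transpose B *v x)) = (transpose B *v x) \<bullet> (transpose B *v x)"
        by (metis dot_lmul_matrix transpose_matrix_vector)
      finally have "x \<bullet> x + t * ((transpose B *v x) \<bullet> (transpose B *v x)) = 0" by simp
      moreover have "0 \<le> t * ((transpose B *v x) \<bullet> (transpose B *v x))" using t by simp
      ultimately have "x \<bullet> x = 0" by (metis add_nonneg_eq_0_iff inner_ge_zero)
      then show ?thesis by simp
    qed
    then show ?thesis
      by (metis invertible_det_nz invertible_left_inverse matrix_left_invertible_ker)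
  qed
  have cont: "continuous_on {0..1} (\<lambda>t. det (S t))"
    unfolding det_def S_def by (intro continuous_intros)
  have "det (S 1) > 0"
  proof (rule ccontr)
    assume "\<not> det (S 1) > 0"
    moreover have "det (S 0) = 1" by (simp add: S_def)
    ultimately obtain t where "0 \<le> t" "det (S t) = 0"
      using IVT2'[of "\<lambda>t. det (S t)" 1 0 0] cont by force
    then show False using nz by blast
  qed
  then show ?thesis by (simp add: S_def)
qed

lemma gram_pos: "0 < det (gram A)"
  unfolding gram_def by (rule det_mat_1_plus_gram_pos)

definition horizontal_jacobian :: "(real ^ 'd \<Rightarrow> real ^ ('d::finite + 'm::finite)) \<Rightarrow> real ^ 'd \<Rightarrow> real ^ 'd ^ 'd" where
  "horizontal_jacobian \<phi> x = (\<chi> i. jacobian \<phi> (at x) $ Inl i)"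

text \<open>
  The values of \<open>\<phi>\<close> satisfy the equations of the graph on the open set \<open>U\<close>, so they can be differentiated: the vertical part of
  the Jacobian is determined by its horizontal part.
\<close>

lemma jacobian_affine_graph_Inr:
  fixes A :: "real ^ 'm::finite ^ ('d::finite option)"
  assumes \<phi>: "local_parametrization (affine_graph A) U \<phi>" and x: "x \<in> U"
  shows "jacobian \<phi> (at x) $ Inr j $ l = (\<Sum>i\<in>UNIV. A $ Some i $ j * jacobian \<phi> (at x) $ Inl i $ l)"
proof -
  let ?J = "jacobian \<phi> (at x)"
  have U: "open U" and img: "\<phi> ` U \<subseteq> affine_graph A" and "\<phi> differentiable (at x)"
    using \<phi> x unfolding local_parametrization_def by (blast dest: openin_imp_subset)+
  then have der: "(\<phi> has_derivative (\<lambda>h. ?J *v h)) (at x)"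
    by (simp add: jacobian_works)
  have comp: "((\<lambda>y. \<phi> y $ k) has_derivative (\<lambda>h. (?J *v h) $ k)) (at x)" for k
    by (rule bounded_linear.has_derivative[OF bounded_linear_vec_nth der])
  have 1: "((\<lambda>y. \<phi> y $ Inr j - A $ None $ j - (\<Sum>i\<in>UNIV. \<phi> y $ Inl i * A $ Some i $ j)) has_derivative
     (\<lambda>h. (?J *v h) $ Inr j - 0 - (\<Sum>i\<in>UNIV. (?J *v h) $ Inl i * A $ Some i $ j))) (at x)"
    by (intro has_derivative_diff has_derivative_sum has_derivative_const has_derivative_mult_left comp)
  have "\<phi> y $ Inr j - A $ None $ j - (\<Sum>i\<in>UNIV. \<phi> y $ Inl i * A $ Some i $ j) = 0" if y: "y \<in> U" for y
  proof -
    obtain z where "\<phi> y = affine_chart A z" using img y by (auto simp: affine_graph_eq_range)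
    then show ?thesis by simp
  qed
  then have 2: "((\<lambda>y. \<phi> y $ Inr j - A $ None $ j - (\<Sum>i\<in>UNIV. \<phi> y $ Inl i * A $ Some i $ j)) has_derivative (\<lambda>h. 0)) (at x)"
    by (intro has_derivative_transform_within_open[OF has_derivative_const U x]) simp
  have "(?J *v axis l 1) $ Inr j - 0 - (\<Sum>i\<in>UNIV. (?J *v axis l 1) $ Inl i * A $ Some i $ j) = 0"
    using has_derivative_unique[OF 1 2] by metis
  then show ?thesis by (simp add: matrix_vector_mult_basis column_def mult.commute)
qed

lemma matrix_add_rdistrib:
  fixes A B :: "real ^ 'n ^ 'm" and C :: "real ^ 'p ^ 'n"
  shows "(A + B) ** C = A ** C + B ** C"
  by (simp add: vec_eq_iff matrix_matrix_mult_def sum.distrib distrib_right)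

text \<open>
  With \<open>H\<close> the horizontal part of the Jacobian \<open>J\<close>, lemma \<open>jacobian_affine_graph_Inr\<close> gives
  \<open>J\<^sup>T J = H\<^sup>T (1 + B B\<^sup>T) H\<close>.
\<close>

lemma volume_density_affine_graph:
  fixes A :: "real ^ 'm::finite ^ ('d::finite option)"
  assumes \<phi>: "local_parametrization (affine_graph A) U \<phi>" and x: "x \<in> U"
  shows "volume_density \<phi> x = sqrt (det (gram A)) * \<bar>det (horizontal_jacobian \<phi> x)\<bar>"
proof -
  let ?J = "jacobian \<phi> (at x)" and ?H = "horizontal_jacobian \<phi> x"
  have low: "(\<chi> j. ?J $ Inr j) = transpose (slope A) ** ?H"
    by (simp add: vec_eq_iff matrix_matrix_mult_def transpose_def slope_def horizontal_jacobian_def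
        jacobian_affine_graph_Inr[OF \<phi> x])
  have "transpose ?J ** ?J = transpose ?H ** ?H + transpose (\<chi> j. ?J $ Inr j) ** (\<chi> j. ?J $ Inr j)"
    by (simp add: vec_eq_iff matrix_matrix_mult_def transpose_def horizontal_jacobian_def sum_UNIV_Plus)
  also have "\<dots> = transpose ?H ** gram A ** ?H"
    unfolding low gram_def
    by (simp add: matrix_transpose_mul matrix_add_ldistrib matrix_add_rdistrib matrix_mul_assoc)
  finally have "det (transpose ?J ** ?J) = det (gram A) * (det ?H)\<^sup>2"
    by (simp add: det_mul power2_eq_square)
  then show ?thesis
    by (simp add: volume_density_def real_sqrt_mult)
qed

text \<open>
  Projecting the pieces of a cover to \<open>\<real>\<^sup>d\<close> gives a cover of \<open>\<real>\<^sup>d\<close>, and the volume of each piece is at least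
  a fixed positive multiple of the Lebesgue measure of its projection.
\<close>

lemma induced_measure_affine_graph:
  fixes A :: "real ^ 'm::finite ^ ('d::finite option)"
  shows "induced_measure TYPE('d) (affine_graph A) (affine_graph A) = \<infinity>"
proof -
  define c where "c = sqrt (det (gram A))"
  have c: "c > 0" using gram_pos by (simp add: c_def)
  have "\<infinity> \<le> (\<Sum>k. \<integral>\<^sup>+ x\<in>B k. ennreal (volume_density (\<phi> k) x) \<partial>lborel)"
    if par: "\<And>k. local_parametrization (affine_graph A) (U k) (\<phi> k)"
      and B: "\<And>k. B k \<in> sets borel" "\<And>k. B k \<subseteq> U k"
      and cov: "affine_graph A \<subseteq> (\<Union>k. \<phi> k ` B k)"
    for U :: "nat \<Rightarrow> (real ^ 'd) set" and \<phi> B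
  proof -
    let ?h = "\<lambda>k x. indicator (B k) x * \<bar>det (horizontal_jacobian (\<phi> k) x)\<bar>"
    have meas: "?h k \<in> borel_measurable borel" for k
    proof -
      have "continuous_on (B k) (\<lambda>x. jacobian (\<phi> k) (at x))"
        using par[of k] B(2)[of k] unfolding local_parametrization_def
        by (blast intro: continuous_on_subset)
      then have "continuous_on (B k) (\<lambda>x. \<bar>det (horizontal_jacobian (\<phi> k) x)\<bar>)"
        unfolding det_def horizontal_jacobian_def by (simp, intro continuous_intros)
      then show ?thesis
        using borel_measurable_continuous_on_indicator[OF B(1)] by fastforce
    qed
    have "\<exists>T\<in>sets borel. (\<lambda>x. \<chi> i. \<phi> k x $ Inl i) ` B k \<subseteq> T \<and> emeasure lborel T \<le> (\<integral>\<^sup>+x. ennreal (?h k x) \<partial>lborel)" for k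
    proof (rule borel_cover_of_image[OF B(1) _ meas])
      fix x assume "x \<in> B k"
      then have "\<phi> k differentiable (at x)"
        using par[of k] B(2)[of k] unfolding local_parametrization_def by blast
      then have der: "(\<phi> k has_derivative (\<lambda>h. jacobian (\<phi> k) (at x) *v h)) (at x within B k)"
        unfolding jacobian_works by (rule has_derivative_at_withinI)
      have "linear (\<lambda>y :: real ^ ('d + 'm). \<chi> i. y $ Inl i)"
        by (rule linearI) (simp_all add: vec_eq_iff)
      then have "bounded_linear (\<lambda>y :: real ^ ('d + 'm). \<chi> i. y $ Inl i)"
        by (simp add: linear_conv_bounded_linear)
      from bounded_linear.has_derivative[OF this der]
      have "((\<lambda>x. \<chi> i. \<phi> k x $ Inl i) has_derivative (\<lambda>h. \<chi> i. (jacobian (\<phi> k) (at x) *v h) $ Inl i)) (at x within B k)" .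
      moreover have "(\<lambda>h. \<chi> i. (jacobian (\<phi> k) (at x) *v h) $ Inl i) = (*v) (horizontal_jacobian (\<phi> k) x)"
        by (auto simp: horizontal_jacobian_def matrix_vector_mult_def)
      ultimately show "((\<lambda>x. \<chi> i. \<phi> k x $ Inl i) has_derivative (*v) (horizontal_jacobian (\<phi> k) x)) (at x within B k)"
        by simp
    qed
    then have "\<forall>k. \<exists>T. T \<in> sets borel \<and> (\<lambda>x. \<chi> i. \<phi> k x $ Inl i) ` B k \<subseteq> T \<and>
        emeasure lborel T \<le> (\<integral>\<^sup>+x. ennreal (?h k x) \<partial>lborel)"
      by (simp only: Bex_def) blast
    from choice[OF this] obtain T where
      "\<forall>k. T k \<in> sets borel \<and> (\<lambda>x. \<chi> i. \<phi> k x $ Inl i) ` B k \<subseteq> T k \<and>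
        emeasure lborel (T k) \<le> (\<integral>\<^sup>+x. ennreal (?h k x) \<partial>lborel)"
      by (rule exE)
    then have T: "T k \<in> sets borel" "(\<lambda>x. \<chi> i. \<phi> k x $ Inl i) ` B k \<subseteq> T k"
        "emeasure lborel (T k) \<le> (\<integral>\<^sup>+x. ennreal (?h k x) \<partial>lborel)" for k
      by (rule allE [where x = k], simp only:)+
    have "(\<Union>k. T k) = UNIV"
    proof (rule UNIV_eq_I[symmetric])
      fix z :: "real ^ 'd"
      have "affine_chart A z \<in> (\<Union>k. \<phi> k ` B k)"
        by (rule subsetD[OF cov]) (simp add: affine_graph_eq_range)
      then obtain k x where "x \<in> B k" "\<phi> k x = affine_chart A z" by (elim UN_E imageE) simp
      moreover from this have "(\<chi> i. \<phi> k x $ Inl i) = z" by (simp add: vec_eq_iff)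
      ultimately show "z \<in> (\<Union>k. T k)" using T(2)[of k] by blast
    qed
    then have "\<infinity> \<le> (\<Sum>k. emeasure lborel (T k))"
      using emeasure_subadditive_countably[of T lborel] T(1) by (auto simp: image_subset_iff)
    also have "(\<Sum>k. emeasure lborel (T k)) \<le> (\<Sum>k. \<integral>\<^sup>+x. ennreal (?h k x) \<partial>lborel)"
      by (rule suminf_le[OF T(3)]) auto
    finally have "\<infinity> \<le> (\<Sum>k. \<integral>\<^sup>+x. ennreal (?h k x) \<partial>lborel)" .
    then have "ennreal c * \<infinity> \<le> (\<Sum>k. ennreal c * (\<integral>\<^sup>+x. ennreal (?h k x) \<partial>lborel))"
      by (simp add: top_unique ennreal_suminf_cmult)
    moreover have "ennreal c * (\<integral>\<^sup>+x. ennreal (?h k x) \<partial>lborel)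
        = (\<integral>\<^sup>+ x\<in>B k. ennreal (volume_density (\<phi> k) x) \<partial>lborel)" for k
    proof -
      have "ennreal c * (\<integral>\<^sup>+x. ennreal (?h k x) \<partial>lborel) = (\<integral>\<^sup>+x. ennreal c * ennreal (?h k x) \<partial>lborel)"
        using meas by (subst nn_integral_cmult) auto
      also have "\<dots> = (\<integral>\<^sup>+ x\<in>B k. ennreal (volume_density (\<phi> k) x) \<partial>lborel)"
      proof (rule nn_integral_cong)
        fix x
        show "ennreal c * ennreal (?h k x) = ennreal (volume_density (\<phi> k) x) * indicator (B k) x"
        proof (cases "x \<in> B k")
          case True
          then have "volume_density (\<phi> k) x = c * \<bar>det (horizontal_jacobian (\<phi> k) x)\<bar>"
            using volume_density_affine_graph[OF par] B(2) by (auto simp: c_def)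
          then show ?thesis using True c by (simp add: ennreal_mult)
        qed simp
      qed
      finally show ?thesis .
    qed
    ultimately show ?thesis using c by (simp add: ennreal_mult_top top_unique)
  qed
  then have "\<infinity> \<le> induced_measure TYPE('d) (affine_graph A) (affine_graph A)"
    unfolding induced_measure_def by (intro Inf_greatest) blast
  then show ?thesis by (simp add: top_unique)
qed

section \<open>Transference from linear forms to simultaneous approximation\<close>

text \<open>
  Khintchine's transference principle by pigeonhole.  Let \<open>|b\<^sub>l| = H\<close> be the largest coefficient.  To each
  \<open>q\<close> from 0 to \<open>H D\<^bsup>n-1\<^esup>\<close> attach the cell of side \<open>1 / D\<close> containing the fractional parts of \<open>q y\<^sub>i\<close>,
  \<open>i \<noteq> l\<close>, and the residue modulo \<open>H\<close> of \<open>q b\<^sub>0\<close> plus the sum of all \<open>b\<^sub>i \<lfloor>q y\<^sub>i\<rfloor>\<close> with \<open>i \<noteq> l\<close>.  Two values of \<open>q\<close> agree in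
  both, and their difference has approximations \<open>p\<^sub>i\<close>, \<open>i \<noteq> l\<close>, with error at most \<open>1 / D\<close>.  Because of the
  equal residues, the equation \<open>b \<cdot> p + q b\<^sub>0 = 0\<close> has an integral solution \<open>p\<^sub>l\<close>.  That equation
  expresses the error of \<open>p\<^sub>l\<close> through the other errors and \<open>q (b \<cdot> y + b\<^sub>0)\<close>.
\<close>

lemma simultaneous_approximation_of_linear_form:
  fixes y :: "'n::finite \<Rightarrow> real" and b :: "'n \<Rightarrow> int"
  assumes H: "\<bar>b l\<bar> = int H" "0 < H" "\<And>i. \<bar>b i\<bar> \<le> int H"
    and D: "0 < D" "real D ^ CARD('n) * \<bar>(\<Sum>i\<in>UNIV. of_int (b i) * y i) + of_int b0\<bar> \<le> 1"
  shows "\<exists>q::nat. 1 \<le> q \<and> q \<le> H * D ^ (CARD('n) - 1) \<and>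
    (\<exists>p :: 'n \<Rightarrow> int. \<forall>i. \<bar>real q * y i - of_int (p i)\<bar> \<le> real CARD('n) / real D)"
proof -
  define e where "e = \<bar>(\<Sum>i\<in>UNIV. of_int (b i) * y i) + of_int b0\<bar>"
  define N where "N = H * D ^ (CARD('n) - 1)"
  let ?R = "UNIV - {l} :: 'n set"
  have cR: "card ?R = CARD('n) - 1" by (simp add: card_Diff_singleton)
  have n1: "CARD('n) \<ge> 1" by (simp add: Suc_leI)
  define f where "f q = ((\<Sum>i\<in>?R. b i * \<lfloor>real q * y i\<rfloor>) + int q * b0) mod int H" for q :: nat
  define g where "g q = restrict (\<lambda>i. nat \<lfloor>real D * frac (real q * y i)\<rfloor>) ?R" for q :: nat
  have cell: "nat \<lfloor>real D * frac z\<rfloor> < D" for z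
  proof -
    have "real D * frac z < real D * 1"
      using D(1) frac_lt_1 by (intro mult_strict_left_mono) auto
    then have "\<lfloor>real D * frac z\<rfloor> < int D" by (simp add: floor_less_iff)
    then show ?thesis using D(1) by (simp add: nat_less_iff)
  qed
  have "\<not> inj_on (\<lambda>q. (f q, g q)) {0..N}"
  proof (rule pigeonhole)
    have sub: "(\<lambda>q. (f q, g q)) ` {0..N} \<subseteq> {0..<int H} \<times> (\<Pi>\<^sub>E i\<in>?R. {0..<D})"
    proof (rule image_subsetI)
      fix q
      have "g q \<in> (\<Pi>\<^sub>E i\<in>?R. {0..<D})"
        unfolding g_def by (rule restrict_PiE_iff[THEN iffD2]) (use cell in simp)
      moreover have "f q \<in> {0..<int H}" using H(2) by (simp add: f_def)
      ultimately show "(f q, g q) \<in> {0..<int H} \<times> (\<Pi>\<^sub>E i\<in>?R. {0..<D})" by blast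
    qed
    have "card ((\<lambda>q. (f q, g q)) ` {0..N}) \<le> card ({0..<int H} \<times> (\<Pi>\<^sub>E i\<in>?R. {0..<D}))"
      by (intro card_mono sub finite_cartesian_product finite_PiE) auto
    also have "\<dots> = N" by (simp add: card_cartesian_product card_PiE N_def cR)
    finally show "card ((\<lambda>q. (f q, g q)) ` {0..N}) < card {0..N}" by simp
  qed
  then obtain q1 q2 where q: "q1 < q2" "q2 \<le> N" "f q1 = f q2" "g q1 = g q2"
    unfolding inj_on_def by (metis (no_types, lifting) atLeastAtMost_iff nat_neq_iff prod.inject)
  define q where "q = q2 - q1"
  define p0 where "p0 i = \<lfloor>real q2 * y i\<rfloor> - \<lfloor>real q1 * y i\<rfloor>" for i
  define s where "s = (\<Sum>i\<in>?R. b i * p0 i) + int q * b0"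
  have rq: "real q = real q2 - real q1" and iq: "int q = int q2 - int q1"
    using q(1) by (auto simp: q_def)
  have close: "\<bar>real q * y i - of_int (p0 i)\<bar> \<le> 1 / real D" if "i \<noteq> l" for i
  proof -
    have "nat \<lfloor>real D * frac (real q1 * y i)\<rfloor> = nat \<lfloor>real D * frac (real q2 * y i)\<rfloor>"
      using fun_cong[OF q(4), of i] that by (simp add: g_def)
    moreover have "0 \<le> \<lfloor>real D * frac z\<rfloor>" for z by (simp add: frac_ge_0)
    ultimately have "\<lfloor>real D * frac (real q1 * y i)\<rfloor> = \<lfloor>real D * frac (real q2 * y i)\<rfloor>"
      by (simp add: eq_nat_nat_iff)
    then have "\<bar>real D * frac (real q2 * y i) - real D * frac (real q1 * y i)\<bar> < 1"
      by linarith
    moreover have "real D * frac (real q2 * y i) - real D * frac (real q1 * y i) = real D * (real q * y i - of_int (p0 i))"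
      by (simp add: frac_def p0_def rq algebra_simps)
    ultimately have "real D * \<bar>real q * y i - of_int (p0 i)\<bar> < 1" by (simp add: abs_mult)
    then show ?thesis using D(1) by (simp add: field_simps)
  qed
  have "int H dvd s"
  proof -
    have "s = ((\<Sum>i\<in>?R. b i * \<lfloor>real q2 * y i\<rfloor>) + int q2 * b0) - ((\<Sum>i\<in>?R. b i * \<lfloor>real q1 * y i\<rfloor>) + int q1 * b0)"
      by (simp add: s_def p0_def iq algebra_simps sum_subtractf)
    then show ?thesis using q(3)[symmetric] unfolding f_def mod_eq_dvd_iff by (simp only:)
  qed
  then have "b l dvd s" by (simp add: H(1)[symmetric])
  then obtain pl where pl: "s = b l * pl" by (elim dvdE)
  define p where "p i = (if i = l then - pl else p0 i)" for i
  have split: "(\<Sum>i\<in>UNIV. h i) = h l + (\<Sum>i\<in>?R. h i)" for h :: "'n \<Rightarrow> real"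
    by (rule sum.remove) auto
  have bal: "of_int (b l) * (real q * y l - of_int (p l))
      = real q * ((\<Sum>i\<in>UNIV. of_int (b i) * y i) + of_int b0) - (\<Sum>i\<in>?R. of_int (b i) * (real q * y i - of_int (p0 i)))"
  proof -
    have "real_of_int s = (\<Sum>i\<in>?R. of_int (b i) * of_int (p0 i)) + real q * of_int b0"
      by (simp add: s_def)
    moreover have "real_of_int s = of_int (b l) * of_int pl" by (simp add: pl)
    ultimately show ?thesis
      unfolding split[of "\<lambda>i. of_int (b i) * y i"]
      by (simp add: p_def algebra_simps sum_subtractf sum_distrib_left)
  qed
  have HD: "real q * e \<le> real H / real D"
  proof -
    have "real q \<le> real H * real D ^ (CARD('n) - 1)"
    proof -
      have "q \<le> N" using q by (simp add: q_def)
      then have "real q \<le> real N" by simp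
      then show ?thesis by (simp add: N_def)
    qed
    then have "real q * e \<le> (real H * real D ^ (CARD('n) - 1)) * e"
      by (rule mult_right_mono) (simp add: e_def)
    moreover have "real D * (real D ^ (CARD('n) - 1) * e) \<le> 1"
      using D(2) n1 unfolding e_def[symmetric] by (metis mult.assoc power_eq_if not_one_le_zero)
    then have "real D ^ (CARD('n) - 1) * e \<le> 1 / real D"
      using D(1) by (simp add: field_simps)
    then have "real H * (real D ^ (CARD('n) - 1) * e) \<le> real H * (1 / real D)"
      by (rule mult_left_mono) simp
    ultimately show ?thesis by (simp add: mult.assoc)
  qed
  have "\<bar>\<Sum>i\<in>?R. of_int (b i) * (real q * y i - of_int (p0 i))\<bar> \<le> (\<Sum>i\<in>?R. real H * (1 / real D))"
  proof (rule order_trans[OF sum_abs], rule sum_mono)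
    fix i assume "i \<in> ?R"
    moreover have "\<bar>real_of_int (b i)\<bar> \<le> real H" using H(3)[of i] by linarith
    ultimately show "\<bar>of_int (b i) * (real q * y i - of_int (p0 i))\<bar> \<le> real H * (1 / real D)"
      unfolding abs_mult using close[of i] by (intro mult_mono) auto
  qed
  also have "\<dots> = (real CARD('n) - 1) * (real H / real D)"
    using n1 cR by (simp add: of_nat_diff)
  finally have *: "\<bar>\<Sum>i\<in>?R. of_int (b i) * (real q * y i - of_int (p0 i))\<bar>
      \<le> (real CARD('n) - 1) * (real H / real D)" .
  have "\<bar>of_int (b l) * (real q * y l - of_int (p l))\<bar> \<le> real H / real D + (real CARD('n) - 1) * (real H / real D)"
  proof -
    have "\<bar>real q * ((\<Sum>i\<in>UNIV. of_int (b i) * y i) + of_int b0)\<bar> \<le> real H / real D"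
      using HD by (simp add: e_def abs_mult)
    then show ?thesis
      unfolding bal using * by (intro order_trans[OF abs_triangle_ineq4] add_mono)
  qed
  moreover have "\<bar>real_of_int (b l)\<bar> = real H" using H(1) by linarith
  moreover have "real H / real D + (real CARD('n) - 1) * (real H / real D) = real H * (real CARD('n) / real D)"
    by (simp add: diff_divide_distrib left_diff_distrib)
  ultimately have "real H * \<bar>real q * y l - of_int (p l)\<bar> \<le> real H * (real CARD('n) / real D)"
    by (simp only: abs_mult)
  then have pl': "\<bar>real q * y l - of_int (p l)\<bar> \<le> real CARD('n) / real D"
    using H(2) by (simp only: mult_le_cancel_left_pos of_nat_0_less_iff)
  have "\<bar>real q * y i - of_int (p i)\<bar> \<le> real CARD('n) / real D" for i
  proof (cases "i = l")
    case False
    have "1 / real D \<le> real CARD('n) / real D" using n1 by (intro divide_right_mono) auto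
    then show ?thesis using close[OF False] False by (simp add: p_def)
  qed (use pl' in simp)
  moreover have "1 \<le> q" "q \<le> N" using q by (auto simp: q_def)
  ultimately show ?thesis unfolding N_def by blast
qed

text \<open>
  Arbitrarily small distances to the integers force infinitely many \<open>q\<close>, unless the distance 0 is
  attained; in that case all multiples of one \<open>q\<close> will do.
\<close>

lemma approximableI:
  fixes y :: "real ^ 'n::finite"
  assumes "\<And>e. 0 < e \<Longrightarrow> \<exists>q::nat. 0 < q \<and> dist_int (real q *\<^sub>R y) < e \<and> dist_int (real q *\<^sub>R y) < real q powr (- \<tau>)"
  shows "y \<in> approximable \<tau>"
proof -
  define S where "S = {q :: nat. q > 0 \<and> dist_int (real q *\<^sub>R y) < real q powr (- \<tau>)}"
  have "infinite S"
  proof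
    assume fin: "finite S"
    show False
    proof (cases "\<exists>q\<in>S. dist_int (real q *\<^sub>R y) = 0")
      case True
      then obtain q where q: "q \<in> S" "dist_int (real q *\<^sub>R y) = 0" by blast
      have "(\<lambda>c. c * q) ` {1..} \<subseteq> S"
      proof (rule image_subsetI)
        fix c :: nat assume "c \<in> {1..}"
        moreover have "dist_int (real (c * q) *\<^sub>R y) = 0"
          using dist_int_scale_eq_0[OF q(2), of c] by simp
        ultimately show "c * q \<in> S" using q(1) by (simp add: S_def)
      qed
      moreover have "inj_on (\<lambda>c. c * q) {1..}" using q(1) by (auto simp: inj_on_def S_def)
      ultimately have "finite {1::nat..}" using fin finite_imageD finite_subset by blast
      then show False by (simp add: infinite_Ici)
    next
      case False
      define e where "e = Min (insert 1 ((\<lambda>q. dist_int (real q *\<^sub>R y)) ` S))"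
      have "0 < e" unfolding e_def using fin False dist_int_nonneg
        by (subst Min_gr_iff) (auto simp: order_le_less)
      then obtain q where q: "0 < q" "dist_int (real q *\<^sub>R y) < e" "dist_int (real q *\<^sub>R y) < real q powr (- \<tau>)"
        using assms by blast
      then have "q \<in> S" by (simp add: S_def)
      then have "e \<le> dist_int (real q *\<^sub>R y)" unfolding e_def using fin by (intro Min_le) auto
      then show False using q(2) by linarith
    qed
  qed
  then show ?thesis by (simp add: approximable_def S_def)
qed

lemma finite_integer_vectors_infnorm_le:
  "finite {q \<in> integer_vectors. infnorm (q :: real ^ 'n::finite) \<le> T}"
proof (rule finite_subset)
  show "{q \<in> integer_vectors. infnorm (q :: real ^ 'n) \<le> T}
      \<subseteq> (\<lambda>z. \<chi> i. of_int (z i)) ` {z. \<forall>i. \<bar>z i\<bar> \<le> \<lfloor>T\<rfloor>}"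
  proof
    fix q :: "real ^ 'n" assume q: "q \<in> {q \<in> integer_vectors. infnorm q \<le> T}"
    then obtain z where z: "q = (\<chi> i. real_of_int (z i))" by (blast elim: integer_vectorsE)
    have "\<bar>z i\<bar> \<le> \<lfloor>T\<rfloor>" for i
      using component_le_infnorm_cart[of q i] q by (simp add: z le_floor_iff)
    then show "q \<in> (\<lambda>z. \<chi> i. of_int (z i)) ` {z. \<forall>i. \<bar>z i\<bar> \<le> \<lfloor>T\<rfloor>}" using z by blast
  qed
qed (intro finite_imageI finite_bounded_int_functions)

text \<open>
  If \<open>v\<close> is the integer vector nearest to \<open>A s\<close>, then
  \<open>(1, x) \<cdot> v - (1, x) A \<cdot> s = (1, x) \<cdot> (v - A s)\<close> is small, and the left side is an integral affine
  form in \<open>\<phi>(x)\<close> with coefficients \<open>b = (v\<^sub>1, \<dots>, v\<^sub>d, -s)\<close> and constant term \<open>b\<^sub>0 = v\<^sub>0\<close>.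
\<close>

lemma chart_near_rational_hyperplane:
  fixes A :: "real ^ 'm::finite ^ ('d::finite option)" and x :: "real ^ 'd"
  assumes s: "s \<in> integer_vectors" "1 \<le> infnorm s" and near: "dist_int (A *v s) < e" and e: "e \<le> 1"
  shows "\<exists>(b :: 'd + 'm \<Rightarrow> int) b0 l H. \<bar>b l\<bar> = int H \<and> 0 < H \<and> (\<forall>i. \<bar>b i\<bar> \<le> int H) \<and>
     real H \<le> (1 + (\<Sum>i\<in>UNIV. \<Sum>j\<in>UNIV. \<bar>A $ i $ j\<bar>)) * infnorm s \<and>
     \<bar>(\<Sum>i\<in>UNIV. of_int (b i) * affine_chart A x $ i) + of_int b0\<bar> \<le> (1 + (\<Sum>i\<in>UNIV. \<bar>x $ i\<bar>)) * e"
proof -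
  obtain z where z: "s = (\<chi> j. real_of_int (z j))" using s(1) by (rule integer_vectorsE)
  obtain v where v: "\<And>i. \<bar>(A *v s) $ i - of_int (v i)\<bar> < e" using near unfolding dist_int_less_iff by blast
  define b :: "'d + 'm \<Rightarrow> int" where "b k = (case k of Inl i \<Rightarrow> v (Some i) | Inr j \<Rightarrow> - z j)" for k
  define H where "H = nat (Max (range (\<lambda>k. \<bar>b k\<bar>)))"
  have bH: "\<bar>b k\<bar> \<le> int H" for k
    unfolding H_def by (simp add: le_nat_iff) (meson Max_ge abs_ge_zero finite finite_imageI order_trans rangeI)
  have "Max (range (\<lambda>k. \<bar>b k\<bar>)) \<in> range (\<lambda>k. \<bar>b k\<bar>)" by (intro Max_in) auto
  then obtain l where "Max (range (\<lambda>k. \<bar>b k\<bar>)) = \<bar>b l\<bar>" by (rule imageE)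
  then have l: "\<bar>b l\<bar> = int H" unfolding H_def by simp
  let ?a = "\<Sum>i\<in>UNIV. \<Sum>j\<in>UNIV. \<bar>A $ i $ j\<bar>"
  have a0: "0 \<le> ?a" by (intro sum_nonneg) auto
  have "0 < H"
  proof -
    obtain j where "infnorm s = \<bar>s $ j\<bar>" using infnorm_attained by blast
    then have "z j \<noteq> 0" using s(2) by (auto simp: z)
    then have "b (Inr j) \<noteq> 0" by (simp add: b_def)
    then show ?thesis using bH[of "Inr j"] by linarith
  qed
  moreover have "real H \<le> (1 + ?a) * infnorm s"
  proof -
    have "\<bar>real_of_int (b k)\<bar> \<le> (1 + ?a) * infnorm s" for k
    proof (cases k)
      case (Inl i)
      have "\<bar>(A *v s) $ Some i\<bar> \<le> (\<Sum>j\<in>UNIV. \<bar>A $ Some i $ j\<bar> * infnorm s)"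
        unfolding matrix_vector_mult_def
        by (simp, rule order_trans[OF sum_abs], rule sum_mono)
          (simp add: abs_mult mult_left_mono component_le_infnorm_cart)
      also have "\<dots> \<le> ?a * infnorm s"
        unfolding sum_distrib_right[symmetric]
        by (intro mult_right_mono member_le_sum[where f = "\<lambda>i. \<Sum>j\<in>UNIV. \<bar>A $ i $ j\<bar>"])
          (auto intro: sum_nonneg simp: infnorm_pos_le)
      finally have "\<bar>real_of_int (v (Some i))\<bar> \<le> ?a * infnorm s + 1"
        using v[of "Some i"] e by linarith
      then show ?thesis using s(2) by (simp add: Inl b_def algebra_simps)
    next
      case (Inr j)
      have "\<bar>real_of_int (z j)\<bar> \<le> 1 * infnorm s" using component_le_infnorm_cart[of s j] by (simp add: z)
      also have "\<dots> \<le> (1 + ?a) * infnorm s"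
        using a0 by (intro mult_right_mono) (auto simp: infnorm_pos_le)
      finally show ?thesis by (simp add: Inr b_def)
    qed
    then show ?thesis using l by (metis of_int_abs of_int_of_nat_eq)
  qed
  moreover have "\<bar>(\<Sum>i\<in>UNIV. of_int (b i) * affine_chart A x $ i) + of_int (v None)\<bar> \<le> (1 + (\<Sum>i\<in>UNIV. \<bar>x $ i\<bar>)) * e"
  proof -
    have "(\<Sum>j\<in>UNIV. real_of_int (z j) * (\<Sum>i\<in>UNIV. x $ i * A $ Some i $ j))
        = (\<Sum>i\<in>UNIV. x $ i * (A *v s) $ Some i)"
      unfolding sum_distrib_left matrix_vector_mult_def by (subst sum.swap) (simp add: z sum_distrib_left mult_ac)
    moreover have "(\<Sum>j\<in>UNIV. real_of_int (z j) * A $ None $ j) = (A *v s) $ None"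
      by (simp add: matrix_vector_mult_def z mult.commute)
    ultimately have "(\<Sum>i\<in>UNIV. of_int (b i) * affine_chart A x $ i) + of_int (v None)
        = (of_int (v None) - (A *v s) $ None) + (\<Sum>i\<in>UNIV. x $ i * (of_int (v (Some i)) - (A *v s) $ Some i))"
      by (simp add: sum_UNIV_Plus b_def algebra_simps sum.distrib sum_subtractf sum_negf)
    moreover have "\<bar>\<Sum>i\<in>UNIV. x $ i * (of_int (v (Some i)) - (A *v s) $ Some i)\<bar> \<le> (\<Sum>i\<in>UNIV. \<bar>x $ i\<bar> * e)"
    proof (rule order_trans[OF sum_abs], rule sum_mono)
      fix i
      have "\<bar>of_int (v (Some i)) - (A *v s) $ Some i\<bar> \<le> e" using v[of "Some i"] by linarith
      then show "\<bar>x $ i * (of_int (v (Some i)) - (A *v s) $ Some i)\<bar> \<le> \<bar>x $ i\<bar> * e"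
        unfolding abs_mult by (rule mult_left_mono) simp
    qed
    moreover have "\<bar>of_int (v None) - (A *v s) $ None\<bar> \<le> e" using v[of None] by linarith
    ultimately show ?thesis by (simp add: algebra_simps sum_distrib_left sum_distrib_right)
  qed
  ultimately show ?thesis using l bH by blast
qed

text \<open>
  For large \<open>s\<close> take \<open>D\<close> of order \<open>|s|\<^bsup>w/n\<^esup>\<close>, the largest size permitted by the transference principle for
  a linear form of size \<open>O(|s|\<^bsup>-w\<^esup>)\<close>.  It yields some \<open>q = O(D\<^sup>\<beta>)\<close> with \<open>\<beta> = n - 1 + n/w\<close> and
  \<open>\<parallel>q \<phi>(x)\<parallel> \<le> n / D\<close>.  Since \<open>w > n\<close>, \<open>\<beta> < n\<close>, so there is room for an exponent strictly between
  \<open>1/n\<close> and \<open>1/\<beta>\<close>.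
\<close>

lemma all_chart_points_approximable:
  fixes A :: "real ^ 'm::finite ^ ('d::finite option)"
  assumes om: "dioph_exponent A > ereal (real (CARD('d) + CARD('m)))"
  shows "\<exists>\<tau> > 1 / real (CARD('d) + CARD('m)). \<forall>x. affine_chart A x \<in> approximable \<tau>"
proof -
  define n where "n = CARD('d) + CARD('m)"
  have n2: "n \<ge> 2" using zero_less_card_finite[where 'a='d] zero_less_card_finite[where 'a='m]
    unfolding n_def by linarith
  obtain w where w: "real n < w" and inf: "infinite {s \<in> integer_vectors. dist_int (A *v s) < infnorm s powr (- w)}"
    using om unfolding dioph_exponent_def less_SUP_iff n_def by auto
  have w0: "w > 0" using w n2 by linarith
  define \<beta> where "\<beta> = real n - 1 + real n / w"
  have "0 \<le> real n / w" "real n / w < 1" using w w0 by simp_all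
  then have \<beta>: "0 < \<beta>" "\<beta> < real n" using n2 unfolding \<beta>_def by linarith+
  define \<tau> where "\<tau> = (1 / real n + 1 / \<beta>) / 2"
  have tau: "1 / real n < \<tau>" "\<tau> < 1 / \<beta>"
  proof -
    have "1 / real n < 1 / \<beta>" using \<beta> by (simp add: frac_less2)
    then show "1 / real n < \<tau>" "\<tau> < 1 / \<beta>" by (simp_all add: \<tau>_def)
  qed
  have "0 < \<tau>" using tau(1) n2 by (smt (verit) divide_nonneg_nonneg of_nat_0_le_iff)
  define \<gamma> where "\<gamma> = 1 - \<tau> * \<beta>"
  have \<gamma>: "\<gamma> > 0" using tau(2) \<beta>(1) by (simp add: \<gamma>_def field_simps)
  have "affine_chart A x \<in> approximable \<tau>" for x
  proof (rule approximableI)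
    fix \<epsilon> :: real assume "0 < \<epsilon>"
    define C where "C = 1 + (\<Sum>i\<in>UNIV. \<bar>x $ i\<bar>)"
    define c where "c = 1 + (\<Sum>i\<in>UNIV. \<Sum>j\<in>UNIV. \<bar>A $ i $ j\<bar>)"
    have C: "C \<ge> 1" and c: "c \<ge> 1" unfolding C_def c_def by (auto intro!: sum_nonneg)
    \<comment> \<open>\<open>K\<close> is the implied constant in \<open>q = O(D\<^sup>\<beta>)\<close>.  \<open>T\<close> is a lower bound for \<open>D\<close> that makes \<open>n / D\<close> smaller
      than both targets, and \<open>L\<close> is the size of \<open>s\<close> that guarantees \<open>D \<ge> T\<close>.\<close>
    define K where "K = c * (C * 2 ^ n) powr (1 / w)"
    have K: "K > 0" using c C unfolding K_def by (intro mult_pos_pos) auto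
    define T where "T = max 2 (max (real n / \<epsilon> + 1) ((real n * K powr \<tau>) powr (1 / \<gamma>) + 1))"
    define L where "L = max 1 ((C * (T + 1) ^ n) powr (1 / w))"
    have "\<not> {s \<in> integer_vectors. dist_int (A *v s) < infnorm s powr (- w)} \<subseteq> {q \<in> integer_vectors. infnorm q \<le> L}"
      using inf finite_integer_vectors_infnorm_le finite_subset by blast
    then obtain s where s: "s \<in> integer_vectors" "dist_int (A *v s) < infnorm s powr (- w)" "L < infnorm s"
      by force
    define r where "r = infnorm s"
    have r1: "1 \<le> r" using s(3) by (simp add: L_def r_def)
    define z where "z = (r powr w / C) powr (1 / real n)"
    have z0: "z > 0" using r1 C by (simp add: z_def)
    have zn: "z ^ n = r powr w / C"
      using r1 C n2 unfolding z_def by (simp add: powr_powr flip: powr_realpow)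
    have zT: "T + 1 \<le> z"
    proof -
      have T0: "0 \<le> T + 1" by (simp add: T_def)
      have "(C * (T + 1) ^ n) powr (1 / w) \<le> r" using s(3) by (simp add: L_def r_def)
      then have "((C * (T + 1) ^ n) powr (1 / w)) powr w \<le> r powr w" using w0 by (intro powr_mono2) auto
      then have "C * (T + 1) ^ n \<le> r powr w" using w0 C T0 by (simp add: powr_powr)
      then have "(T + 1) ^ n \<le> z ^ n" unfolding zn using C by (simp add: field_simps)
      then show ?thesis using z0 n2 by (simp add: power_mono_iff T0)
    qed
    define D where "D = nat \<lfloor>z\<rfloor>"
    have D: "real D \<le> z" "T \<le> real D" "z \<le> 2 * real D" "0 < D"
    proof -
      have "T \<ge> 2" by (simp add: T_def)
      have "real D = of_int \<lfloor>z\<rfloor>" using z0 by (simp add: D_def)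
      then show "real D \<le> z" "T \<le> real D" "z \<le> 2 * real D" "0 < D"
        using zT \<open>T \<ge> 2\<close> by linarith+
    qed
    have e1: "r powr (- w) \<le> 1" using r1 w0 by (simp add: powr_minus ge_one_powr_ge_zero inverse_le_1_iff)
    obtain b :: "'d + 'm \<Rightarrow> int" and b0 l H where b: "\<bar>b l\<bar> = int H" "0 < H" "\<And>i. \<bar>b i\<bar> \<le> int H"
      "real H \<le> c * r" "\<bar>(\<Sum>i\<in>UNIV. of_int (b i) * affine_chart A x $ i) + of_int b0\<bar> \<le> C * r powr (- w)"
      using chart_near_rational_hyperplane[OF s(1) _ s(2), of x] r1 e1 unfolding c_def C_def r_def by blast
    have "real D ^ n * \<bar>(\<Sum>i\<in>UNIV. of_int (b i) * affine_chart A x $ i) + of_int b0\<bar> \<le> z ^ n * (C * r powr (- w))"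
      using D(1) b(5) z0 by (intro mult_mono power_mono) auto
    also have "\<dots> = 1" unfolding zn using C r1 by (simp add: powr_minus)
    finally have small: "real D ^ CARD('d + 'm) * \<bar>(\<Sum>i\<in>UNIV. of_int (b i) * affine_chart A x $ i) + of_int b0\<bar> \<le> 1"
      by (simp add: n_def)
    obtain q p where q: "1 \<le> q" "q \<le> H * D ^ (n - 1)"
      and p: "\<And>i. \<bar>real q * affine_chart A x $ i - of_int (p i)\<bar> \<le> real n / real D"
      using simultaneous_approximation_of_linear_form[OF b(1-3) D(4) small] by (auto simp: n_def)
    have dist: "dist_int (real q *\<^sub>R affine_chart A x) < t" if "real n / real D < t" for t
      unfolding dist_int_less_iff using p that by (intro exI[of _ p]) (auto intro: le_less_trans)
    have "real n / real D < \<epsilon>"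
    proof -
      have "real n / \<epsilon> < real D" using D(2) by (simp add: T_def)
      then show ?thesis using \<open>0 < \<epsilon>\<close> D(4) by (simp add: field_simps)
    qed
    moreover have "real n / real D < real q powr (- \<tau>)"
    proof -
      have "r \<le> (C * 2 ^ n) powr (1 / w) * real D powr (real n / w)"
      proof -
        have "r powr w = C * z ^ n" unfolding zn using C by simp
        also have "\<dots> \<le> C * (2 * real D) ^ n" using C D(3) z0 by (intro mult_left_mono power_mono) auto
        finally have "(r powr w) powr (1 / w) \<le> (C * (2 * real D) ^ n) powr (1 / w)"
          using w0 by (intro powr_mono2) auto
        also have "(r powr w) powr (1 / w) = r" using r1 w0 by (simp add: powr_powr)
        also have "(C * (2 * real D) ^ n) powr (1 / w) = (C * 2 ^ n) powr (1 / w) * (real D ^ n) powr (1 / w)"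
          using C by (simp add: power_mult_distrib powr_mult mult.assoc)
        also have "(real D ^ n) powr (1 / w) = real D powr (real n / w)"
          using D(4) by (simp add: powr_powr flip: powr_realpow)
        finally show ?thesis .
      qed
      then have "c * r \<le> K * real D powr (real n / w)"
        using c unfolding K_def by (simp add: mult.assoc)
      then have HK: "real H \<le> K * real D powr (real n / w)" using b(4) by linarith
      have "real q \<le> real (H * D ^ (n - 1))" using q(2) by (simp only: of_nat_le_iff)
      also have "\<dots> = real H * real D ^ (n - 1)" by simp
      also have "\<dots> \<le> (K * real D powr (real n / w)) * real D ^ (n - 1)"
        using HK by (intro mult_right_mono) auto
      also have "real D ^ (n - 1) = real D powr (real n - 1)"
        using D(4) n2 by (simp add: of_nat_diff flip: powr_realpow)
      also have "(K * real D powr (real n / w)) * real D powr (real n - 1) = K * real D powr \<beta>"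
        by (simp add: \<beta>_def powr_add mult_ac)
      finally have qK: "real q \<le> K * real D powr \<beta>" .
      have "real n * K powr \<tau> < real D powr \<gamma>"
      proof -
        have "(real n * K powr \<tau>) powr (1 / \<gamma>) < real D" using D(2) by (simp add: T_def)
        then have "((real n * K powr \<tau>) powr (1 / \<gamma>)) powr \<gamma> < real D powr \<gamma>"
          using \<gamma> by (intro powr_less_mono2) auto
        then show ?thesis using \<gamma> n2 K by (simp add: powr_powr)
      qed
      then have "real n * K powr \<tau> * (K powr (- \<tau>) / real D) < real D powr \<gamma> * (K powr (- \<tau>) / real D)"
        using K D(4) by (intro mult_strict_right_mono) auto
      moreover have "real n * K powr \<tau> * (K powr (- \<tau>) / real D) = real n / real D"
        using K by (simp add: powr_minus_divide)
      ultimately have "real n / real D < real D powr \<gamma> * (K powr (- \<tau>) / real D)"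
        by linarith
      also have "\<dots> = (K * real D powr \<beta>) powr (- \<tau>)"
        using K D(4) by (simp add: \<gamma>_def powr_mult powr_powr powr_diff powr_minus field_simps)
      also have "\<dots> \<le> real q powr (- \<tau>)"
        using qK q(1) \<open>0 < \<tau>\<close> by (intro powr_mono2') auto
      finally show ?thesis .
    qed
    ultimately show "\<exists>q::nat. 0 < q \<and> dist_int (real q *\<^sub>R affine_chart A x) < \<epsilon> \<and>
        dist_int (real q *\<^sub>R affine_chart A x) < real q powr (- \<tau>)"
      using dist q(1) by (intro exI[of _ q]) auto
  qed
  then show ?thesis using tau(1) unfolding n_def by blast
qed

section \<open>The equivalence\<close>

theorem theorem1p1:
  fixes A :: "real ^ 'm::finite ^ ('d::finite option)"
  shows "extremal TYPE('d) (affine_graph A) \<longleftrightarrow>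
    dioph_exponent A \<le> ereal (real (CARD('d) + CARD('m)))"
proof
  assume ext: "extremal TYPE('d) (affine_graph A)"
  show "dioph_exponent A \<le> ereal (real (CARD('d) + CARD('m)))"
  proof (rule ccontr)
    assume "\<not> dioph_exponent A \<le> ereal (real (CARD('d) + CARD('m)))"
    then have "dioph_exponent A > ereal (real (CARD('d) + CARD('m)))" by (simp only: not_le)
    then obtain \<tau> where \<tau>: "\<tau> > 1 / real (CARD('d) + CARD('m))"
        and "\<And>x. affine_chart A x \<in> approximable \<tau>"
      using all_chart_points_approximable by blast
    then have "approximable \<tau> \<inter> affine_graph A = affine_graph A"
      by (auto simp: affine_graph_eq_range)
    moreover have "induced_measure TYPE('d) (affine_graph A) (approximable \<tau> \<inter> affine_graph A) = 0"
      using ext \<tau> unfolding extremal_def by simp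
    ultimately show False by (simp add: induced_measure_affine_graph)
  qed
qed (rule extremal_if_exponent_le)

end
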